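(* Let $t$ be a nonnegative integer, and let $G$ be a sparse-dense graph with respect to classes $\mathcal S$ (sparse) and $\mathcal D$ (dense), such that $\mathcal D$ is a subclass of the class of $\overline{K_t}$-free graphs, and $\mathcal S$ is a graph class that is recognizable in $T_1(n)$ time on $n$-vertex graphs and for whose $n$-vertex members all maximal independent sets can be enumerated in $T_2(n)$ time. Then all maximal independent sets of $G$ can be enumerated in $(T_1(n)+T_2(n))\cdot n^{\mathcal{O}(t)}$ time, where $n=|V(G)|$.
   Context: Graphs are finite, simple and undirected. Classes $\mathcal S$ and $\mathcal D$ of graphs are called classes of sparse and dense graphs, respectively, if both are closed under taking induced subgraphs and there is a constant $c$ (depending only on the two fixed classes) such that $|S\cap D|\le c$ for any $S\in\mathcal S$ and $D\in\mathcal D$ (here $S$, $D$ are identified with vertex subsets, of a common graph, inducing graphs in the respective class). A sparse-dense partition of a graph $G$ with respect to $\mathcal S$ and $\mathcal D$ is a partition $V(G)=S\cup D$ into two disjoint parts such that $S\in\mathcal S$ and $D\in\mathcal D$ (i.e., the induced subgraphs $G[S]$, $G[D]$ belong to $\mathcal S$, $\mathcal D$). A graph admitting such a partition is called a sparse-dense graph with respect to $\mathcal S$ and $\mathcal D$. A graph is $\overline{K_t}$-free if it has no independent set of size $t$ (equivalently, its complement is $K_t$-free). A maximal independent set is an independent set not properly contained in another independent set. The input of the algorithm is the graph $G$; no sparse-dense partition is given.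
   Formalization: The time bounds T_1 and T_2 are assumed nondecreasing; otherwise the claim fails with a uniform exponent constant (𝒮 = graphs on at most N vertices, 𝒟 = graphs on at most one vertex, n = N+1). The bound is stated for n ≥ 2. *)

theory Defs
  imports "Graph_Theory.Pair_Digraph" "Graph_Theory.Digraph_Isomorphism"
begin

section \<open>Graphs and graph classes\<close>

text \<open>
  A finite simple undirected graph is a \<open>pair_graph\<close>: a finite vertex set together with a
  symmetric irreflexive set of arcs.  Since every finite graph is isomorphic to one whose vertices
  are natural numbers, a graph class is an isomorphism-closed set of graphs on natural numbers.
\<close>

type_synonym ngraph = "nat pair_pre_digraph"

definition graph_class :: "ngraph set \<Rightarrow> bool" where
  "graph_class \<C> \<longleftrightarrow>
     (\<forall>G\<in>\<C>. pair_graph G) \<and>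
     (\<forall>G H. G \<in> \<C> \<and> pair_graph H \<and> digraph_iso (with_proj G) (with_proj H) \<longrightarrow> H \<in> \<C>)"

definition induced :: "'a pair_pre_digraph \<Rightarrow> 'a set \<Rightarrow> 'a pair_pre_digraph" where
  "induced G A = \<lparr>pverts = A, parcs = {e \<in> parcs G. fst e \<in> A \<and> snd e \<in> A}\<rparr>"

lemma with_proj_induced: "with_proj (induced G A) = with_proj G \<restriction> A"
  by (simp add: induced_def with_proj_def induce_subgraph_def)

definition hereditary :: "ngraph set \<Rightarrow> bool" where
  "hereditary \<C> \<longleftrightarrow> (\<forall>G\<in>\<C>. \<forall>A\<subseteq>pverts G. induced G A \<in> \<C>)"

definition sparse_dense_classes :: "nat \<Rightarrow> ngraph set \<Rightarrow> ngraph set \<Rightarrow> bool" where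
  "sparse_dense_classes c \<S> \<D> \<longleftrightarrow>
     graph_class \<S> \<and> graph_class \<D> \<and> hereditary \<S> \<and> hereditary \<D> \<and>
     (\<forall>G A B. pair_graph G \<and> A \<subseteq> pverts G \<and> B \<subseteq> pverts G \<and>
        induced G A \<in> \<S> \<and> induced G B \<in> \<D> \<longrightarrow> card (A \<inter> B) \<le> c)"

definition sparse_dense_partition ::
    "ngraph set \<Rightarrow> ngraph set \<Rightarrow> ngraph \<Rightarrow> nat set \<Rightarrow> nat set \<Rightarrow> bool" where
  "sparse_dense_partition \<S> \<D> G A B \<longleftrightarrow>
     A \<union> B = pverts G \<and> A \<inter> B = {} \<and> induced G A \<in> \<S> \<and> induced G B \<in> \<D>"

definition sparse_dense_graphs :: "ngraph set \<Rightarrow> ngraph set \<Rightarrow> ngraph set" where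
  "sparse_dense_graphs \<S> \<D> = {G. pair_graph G \<and> (\<exists>A B. sparse_dense_partition \<S> \<D> G A B)}"

definition independent_set :: "'a pair_pre_digraph \<Rightarrow> 'a set \<Rightarrow> bool" where
  "independent_set G I \<longleftrightarrow> I \<subseteq> pverts G \<and> (\<forall>u\<in>I. \<forall>v\<in>I. (u, v) \<notin> parcs G)"

definition maximal_independent_set :: "'a pair_pre_digraph \<Rightarrow> 'a set \<Rightarrow> bool" where
  "maximal_independent_set G I \<longleftrightarrow>
     independent_set G I \<and> \<not> (\<exists>J. independent_set G J \<and> I \<subset> J)"

definition co_clique_free_graphs :: "nat \<Rightarrow> ngraph set" where
  "co_clique_free_graphs t = {G. pair_graph G \<and> \<not> (\<exists>I. independent_set G I \<and> card I = t)}"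


section \<open>Model of computation\<close>

text \<open>
  A unit-cost RAM with structured control flow: finitely many registers and finitely many
  unbounded arrays (those named by the program), all holding natural numbers.  The arithmetic
  operations are addition and truncated subtraction only, so that after \<open>k\<close> steps
  the number of bits of any value has grown by at most \<open>k\<close>; multiplication
  at unit cost would make the model unrealistically powerful.
\<close>

record store =
  reg :: "nat \<Rightarrow> nat"
  arr :: "nat \<Rightarrow> nat \<Rightarrow> nat"

datatype com =
    Skip
  | Const nat nat        \<comment> \<open>\<open>Const x k\<close>: \<open>x := k\<close>\<close>
  | Add nat nat nat      \<comment> \<open>\<open>Add x y z\<close>: \<open>x := y + z\<close>\<close>
  | Sub nat nat nat      \<comment> \<open>\<open>Sub x y z\<close>: \<open>x := y - z\<close>\<close>
  | Load nat nat nat     \<comment> \<open>\<open>Load x a y\<close>: \<open>x := a[y]\<close>\<close>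
  | Store nat nat nat    \<comment> \<open>\<open>Store a x y\<close>: \<open>a[x] := y\<close>\<close>
  | Seq com com
  | IfNZ nat com com
  | WhileNZ nat com

text \<open>\<open>exec P s k s'\<close>: started in \<open>s\<close>, the program \<open>P\<close> halts in \<open>s'\<close> after exactly \<open>k\<close> steps.\<close>

inductive exec :: "com \<Rightarrow> store \<Rightarrow> nat \<Rightarrow> store \<Rightarrow> bool" where
  Skip: "exec Skip s 1 s"
| Const: "exec (Const x k) s 1 (s\<lparr>reg := (reg s)(x := k)\<rparr>)"
| Add: "exec (Add x y z) s 1 (s\<lparr>reg := (reg s)(x := reg s y + reg s z)\<rparr>)"
| Sub: "exec (Sub x y z) s 1 (s\<lparr>reg := (reg s)(x := reg s y - reg s z)\<rparr>)"
| Load: "exec (Load x a y) s 1 (s\<lparr>reg := (reg s)(x := arr s a (reg s y))\<rparr>)"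
| Store: "exec (Store a x y) s 1
            (s\<lparr>arr := (arr s)(a := (arr s a)(reg s x := reg s y))\<rparr>)"
| Seq: "exec P s k s' \<Longrightarrow> exec Q s' l s'' \<Longrightarrow> exec (Seq P Q) s (k + l) s''"
| IfTrue: "reg s x \<noteq> 0 \<Longrightarrow> exec P s k s' \<Longrightarrow> exec (IfNZ x P Q) s (k + 1) s'"
| IfFalse: "reg s x = 0 \<Longrightarrow> exec Q s k s' \<Longrightarrow> exec (IfNZ x P Q) s (k + 1) s'"
| WhileFalse: "reg s x = 0 \<Longrightarrow> exec (WhileNZ x P) s 1 s"
| WhileTrue: "reg s x \<noteq> 0 \<Longrightarrow> exec P s k s' \<Longrightarrow> exec (WhileNZ x P) s' l s'' \<Longrightarrow>
    exec (WhileNZ x P) s (k + l + 1) s''"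

lemma exec_deterministic:
  "exec P s k s' \<Longrightarrow> exec P s l s'' \<Longrightarrow> l = k \<and> s'' = s'"
proof (induction arbitrary: l s'' rule: exec.induct)
  case (Seq P s k s' Q m t)
  from Seq.prems obtain k1 s1 l1
    where 1: "exec P s k1 s1" and 2: "exec Q s1 l1 s''" and l: "l = k1 + l1"
    by (cases rule: exec.cases) simp_all
  have eq: "k1 = k" "s1 = s'" using Seq.IH(1)[OF 1] by simp_all
  show ?case using Seq.IH(2)[OF 2[unfolded eq]] eq l by simp
next
  case (IfTrue s x P k s' Q)
  from IfTrue.prems IfTrue.hyps obtain k1 where "exec P s k1 s''" "l = k1 + 1"
    by (cases rule: exec.cases) simp_all
  with IfTrue.IH show ?case by simp
next
  case (IfFalse s x Q k s' P)
  from IfFalse.prems IfFalse.hyps obtain k1 where "exec Q s k1 s''" "l = k1 + 1"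
    by (cases rule: exec.cases) simp_all
  with IfFalse.IH show ?case by simp
next
  case (WhileFalse s x P)
  from WhileFalse.prems WhileFalse.hyps show ?case
    by (cases rule: exec.cases) simp_all
next
  case (WhileTrue s x P k s' m t)
  from WhileTrue.prems WhileTrue.hyps obtain k1 s1 l1
    where 1: "exec P s k1 s1" and 2: "exec (WhileNZ x P) s1 l1 s''" and l: "l = k1 + l1 + 1"
    by (cases rule: exec.cases) simp_all
  have eq: "k1 = k" "s1 = s'" using WhileTrue.IH(1)[OF 1] by simp_all
  show ?case using WhileTrue.IH(2)[OF 2[unfolded eq]] eq l by simp
qed (erule exec.cases; simp)+

lemma exec_pos: "exec P s k s' \<Longrightarrow> 0 < k"
  by (induction rule: exec.induct) auto


section \<open>Graph algorithms\<close>

text \<open>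
  An input graph has vertex set \<open>{..<n}\<close>, where \<open>n\<close> is passed in register 0 and the adjacency
  matrix, row by row, in array 0; everything else is initially 0.
\<close>

definition input_store :: "ngraph \<Rightarrow> store" where
  "input_store G = (let n = card (pverts G) in
     \<lparr>reg = (\<lambda>x. if x = 0 then n else 0),
      arr = (\<lambda>a i. if a = 0 \<and> i < n * n \<and> (i div n, i mod n) \<in> parcs G then 1 else 0)\<rparr>)"

text \<open>The answer of a recognition algorithm is whether register 0 finally is nonzero.\<close>

definition recognizable_in_time :: "ngraph set \<Rightarrow> (nat \<Rightarrow> nat) \<Rightarrow> bool" where
  "recognizable_in_time \<C> T \<longleftrightarrow>
     (\<exists>P. \<forall>n G. pair_graph G \<and> pverts G = {..<n} \<longrightarrow>
        (\<exists>k s. exec P (input_store G) k s \<and> k \<le> T n \<and> (reg s 0 \<noteq> 0 \<longleftrightarrow> G \<in> \<C>)))"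

text \<open>
  An enumeration algorithm leaves the number of listed vertex sets in register 0 and their
  characteristic vectors, each of length \<open>n\<close>, consecutively in array 1.
\<close>

definition listed_sets :: "nat \<Rightarrow> store \<Rightarrow> nat set list" where
  "listed_sets n s = map (\<lambda>i. {v. v < n \<and> arr s 1 (i * n + v) \<noteq> 0}) [0..<reg s 0]"

definition MIS_enumerable_in_time :: "ngraph set \<Rightarrow> (nat \<Rightarrow> nat) \<Rightarrow> bool" where
  "MIS_enumerable_in_time \<C> T \<longleftrightarrow>
     (\<exists>P. \<forall>n G. G \<in> \<C> \<and> pverts G = {..<n} \<longrightarrow>
        (\<exists>k s. exec P (input_store G) k s \<and> k \<le> T n \<and>
           distinct (listed_sets n s) \<and>
           set (listed_sets n s) = {I. maximal_independent_set G I}))"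

end

theory Submission
  imports Defs
begin

text \<open>
  Let \<open>A \<union> B\<close> be an (unknown) sparse-dense partition of \<open>G\<close>.  If \<open>G[X]\<close> is sparse and \<open>|X| < |A|\<close>,
  then \<open>X\<close> can be enlarged within the sparse class by removing the at most \<open>c\<close> vertices of \<open>X \<inter> B\<close> and
  adding at most \<open>c + 1\<close> vertices of \<open>A\<close>.  So local search over symmetric differences with sets of
  size at most \<open>2 * c + 1\<close> reaches \<open>|X| \<ge> |A|\<close> after at most \<open>n\<close> improvements.  Then
  \<open>|A - X| \<le> |X - A| = |X \<inter> B| \<le> c\<close>, hence every independent set has at most \<open>t + c\<close> vertices outside \<open>X\<close>.
  A maximal independent set \<open>I\<close> with \<open>J = I - X\<close> arises from a maximal independent set of the sparse
  graph induced by the vertices of \<open>X\<close> without neighbours in \<open>J\<close>; it is listed only once because \<open>J\<close>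
  is determined by \<open>I\<close>.

  The exponent may depend on \<open>c\<close> only, so the cost of running the given programs repeatedly must not
  depend on the number of registers and arrays they use.
\<close>

section \<open>Programs and running time\<close>

text \<open>No recognition algorithm for the dense class is given, so a partition cannot be tested,
  let alone searched for. The way out is that any sparse \<open>X\<close> with
  \<open>card A \<le> card X\<close> serves as well as \<open>A\<close>, even if its complement is
  not dense: the program only ever tests membership in \<open>\<S>\<close> and compares sizes of its
  own sets, while the unknown parts occur in the analysis alone. The bound has no leading factor,
  and its exponent is fixed before the programs are known. So every overhead has to be an absolute
  constant or a power of \<open>n\<close> with exponent bounded in terms of \<open>c\<close> and
  \<open>t\<close>; for \<open>n\<close> at least 2 the constants also become powers of
  \<open>n\<close>. A loop over the output of a given program fits in only if the length of that
  output is bounded by the running time. This is not automatic, since a register can grow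
  exponentially in the number of steps; it follows from the listed sets being distinct. Without
  multiplication, matrix positions are tracked by counters, and Boolean operations are sums and
  truncated differences of bits.\<close>

definition wp :: "com \<Rightarrow> (store \<Rightarrow> nat \<Rightarrow> bool) \<Rightarrow> store \<Rightarrow> nat \<Rightarrow> bool" where
  "wp P Q s t \<longleftrightarrow> (\<exists>k s'. exec P s k s' \<and> Q s' (t + k))"

lemma wp_mono: "wp P Q s t \<Longrightarrow> (\<And>s' t'. Q s' t' \<Longrightarrow> R s' t') \<Longrightarrow> wp P R s t"
  unfolding wp_def by blast

inductive_cases exec_SeqE [elim!]: "exec (Seq P R) s k s'"
inductive_cases exec_IfE: "exec (IfNZ x P R) s k s'"

text \<open>Programs are deterministic, so the run in the existential is unique. Specifications of
  single instructions thereby become equations, and the simplifier executes straight-line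
  code.\<close>

lemma wp_exec: "exec P s k s' \<Longrightarrow> wp P Q s t = Q s' (t + k)"
  unfolding wp_def by (metis exec_deterministic)

lemma wp_Skip [simp]: "wp Skip Q s t = Q s (t + 1)"
  by (rule wp_exec[OF exec.Skip])

lemma wp_Const [simp]: "wp (Const x c) Q s t = Q (s\<lparr>reg := (reg s)(x := c)\<rparr>) (t + 1)"
  by (rule wp_exec[OF exec.Const])

lemma wp_Add [simp]:
  "wp (Add x y z) Q s t = Q (s\<lparr>reg := (reg s)(x := reg s y + reg s z)\<rparr>) (t + 1)"
  by (rule wp_exec[OF exec.Add])

lemma wp_Sub [simp]:
  "wp (Sub x y z) Q s t = Q (s\<lparr>reg := (reg s)(x := reg s y - reg s z)\<rparr>) (t + 1)"
  by (rule wp_exec[OF exec.Sub])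

lemma wp_Load [simp]:
  "wp (Load x a y) Q s t = Q (s\<lparr>reg := (reg s)(x := arr s a (reg s y))\<rparr>) (t + 1)"
  by (rule wp_exec[OF exec.Load])

lemma wp_Store [simp]:
  "wp (Store a x y) Q s t =
     Q (s\<lparr>arr := (arr s)(a := (arr s a)(reg s x := reg s y))\<rparr>) (t + 1)"
  by (rule wp_exec[OF exec.Store])

lemma wp_Seq [simp]: "wp (Seq P R) Q s t = wp P (wp R Q) s t"
  unfolding wp_def by (fastforce intro: exec.intros simp: add.assoc)

lemma wp_If [simp]:
  "wp (IfNZ x P R) Q s t = (if reg s x \<noteq> 0 then wp P Q s (t + 1) else wp R Q s (t + 1))"
proof (cases "reg s x = 0")
  case True
  then have "exec (IfNZ x P R) s k s' \<longleftrightarrow> (\<exists>l. exec R s l s' \<and> k = l + 1)" for k s'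
    by (auto elim: exec_IfE intro: exec.IfFalse simp del: One_nat_def)
  with True show ?thesis by (simp add: wp_def) (metis add.assoc add_Suc_right)
next
  case False
  then have "exec (IfNZ x P R) s k s' \<longleftrightarrow> (\<exists>l. exec P s l s' \<and> k = l + 1)" for k s'
    by (auto elim: exec_IfE intro: exec.IfTrue simp del: One_nat_def)
  with False show ?thesis by (simp add: wp_def) (metis add.assoc add_Suc_right)
qed

lemma wp_While_False: "reg s x = 0 \<Longrightarrow> Q s (t + 1) \<Longrightarrow> wp (WhileNZ x P) Q s t"
  unfolding wp_def by (blast intro: exec.intros)

lemma wp_While_True:
  assumes "reg s x \<noteq> 0" "wp P (wp (WhileNZ x P) Q) s (t + 1)"
  shows "wp (WhileNZ x P) Q s t"
proof -
  from assms(2) obtain k s' l s'' where "exec P s k s'" "exec (WhileNZ x P) s' l s''"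
    "Q s'' (t + 1 + k + l)"
    unfolding wp_def by blast
  moreover from this assms(1) have "exec (WhileNZ x P) s (k + l + 1) s''"
    by (blast intro: exec.WhileTrue)
  ultimately show ?thesis unfolding wp_def
    by (intro exI[of _ "k + l + 1"] exI[of _ s'']) (simp add: algebra_simps)
qed

section \<open>Frame conditions: what a program cannot change\<close>

primrec written_regs :: "com \<Rightarrow> nat set" where
  "written_regs Skip = {}"
| "written_regs (Const x c) = {x}"
| "written_regs (Add x y z) = {x}"
| "written_regs (Sub x y z) = {x}"
| "written_regs (Load x a y) = {x}"
| "written_regs (Store a x y) = {}"
| "written_regs (Seq P Q) = written_regs P \<union> written_regs Q"
| "written_regs (IfNZ x P Q) = written_regs P \<union> written_regs Q"
| "written_regs (WhileNZ x P) = written_regs P"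

primrec written_arrs :: "com \<Rightarrow> nat set" where
  "written_arrs Skip = {}"
| "written_arrs (Const x c) = {}"
| "written_arrs (Add x y z) = {}"
| "written_arrs (Sub x y z) = {}"
| "written_arrs (Load x a y) = {}"
| "written_arrs (Store a x y) = {a}"
| "written_arrs (Seq P Q) = written_arrs P \<union> written_arrs Q"
| "written_arrs (IfNZ x P Q) = written_arrs P \<union> written_arrs Q"
| "written_arrs (WhileNZ x P) = written_arrs P"

definition frame :: "nat set \<Rightarrow> nat set \<Rightarrow> store \<Rightarrow> store \<Rightarrow> bool" where
  "frame R A s s' \<longleftrightarrow> (\<forall>x. x \<notin> R \<longrightarrow> reg s' x = reg s x) \<and> (\<forall>a. a \<notin> A \<longrightarrow> arr s' a = arr s a)"

lemma frame_refl [simp]: "frame R A s s"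
  by (simp add: frame_def)

lemma frame_reg: "frame R A s s' \<Longrightarrow> x \<notin> R \<Longrightarrow> reg s' x = reg s x"
  by (simp add: frame_def)

lemma frame_arr: "frame R A s s' \<Longrightarrow> a \<notin> A \<Longrightarrow> arr s' a = arr s a"
  by (simp add: frame_def)

lemma exec_frame: "exec P s k s' \<Longrightarrow> frame (written_regs P) (written_arrs P) s s'"
  by (induction rule: exec.induct) (auto simp: frame_def)

lemma wp_frame:
  assumes "wp P Q s t"
  shows "wp P (\<lambda>s' t'. Q s' t' \<and> frame (written_regs P) (written_arrs P) s s') s t"
  using assms exec_frame unfolding wp_def by blast

text \<open>Whatever the program text cannot write is added to the postcondition for free, so
  specifications and invariants need only mention what changes.\<close>

lemma wp_conseq:
  assumes "wp P Q s t"
    and "\<And>s' t'. Q s' t' \<Longrightarrow> frame (written_regs P) (written_arrs P) s s' \<Longrightarrow> R s' t'"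
  shows "wp P R s t"
  using wp_mono[OF wp_frame[OF assms(1)]] assms(2) by blast

text \<open>Register 1 holds the constant 1 throughout.\<close>

definition for_loop :: "nat \<Rightarrow> nat \<Rightarrow> nat \<Rightarrow> com \<Rightarrow> com" where
  "for_loop x g b P =
     Seq (Const x 0) (Seq (Sub g b x) (WhileNZ g (Seq P (Seq (Add x x 1) (Sub g b x)))))"

lemma written_for_loop [simp]:
  "written_regs (for_loop x g b P) = {x, g} \<union> written_regs P"
  "written_arrs (for_loop x g b P) = written_arrs P"
  by (auto simp: for_loop_def)

text \<open>The 3 fixed steps are the two initializations and the last test; the 3 steps per round
  are the test, the increment and the new guard. The invariant is demanded of the store in which
  counter and guard are already advanced. The body may assume that everything outside the loop's
  written registers and arrays still has its value from before the loop.\<close>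

lemma wp_for_loop:
  fixes B N :: nat
  assumes regs: "reg s 1 = 1" "reg s b = N" "distinct [x, g, b]" "x \<noteq> 1" "g \<noteq> 1"
    and disj: "x \<notin> written_regs P" "b \<notin> written_regs P" "1 \<notin> written_regs P"
    and init: "I 0 (s\<lparr>reg := (reg s)(x := 0, g := N)\<rparr>)"
    and body: "\<And>i s' t. i < N \<Longrightarrow> I i s' \<Longrightarrow> reg s' x = i \<Longrightarrow>
      frame ({x, g} \<union> written_regs P) (written_arrs P) s s' \<Longrightarrow>
      wp P (\<lambda>s'' t'. I (Suc i) (s''\<lparr>reg := (reg s'')(x := Suc i, g := N - Suc i)\<rparr>) \<and> t' \<le> t + B) s' t"
  shows "wp (for_loop x g b P)
    (\<lambda>s' t'. I N s' \<and> frame ({x, g} \<union> written_regs P) (written_arrs P) s s' \<and>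
       t' \<le> t + 3 + N * (B + 3)) s t"
proof -
  let ?R = "{x, g} \<union> written_regs P" and ?A = "written_arrs P"
  let ?W = "WhileNZ g (Seq P (Seq (Add x x 1) (Sub g b x)))"
  have loop: "wp ?W (\<lambda>s' t'. I N s' \<and> frame ?R ?A s s' \<and> t' \<le> t + 1 + (N - i) * (B + 3)) s' t"
    if "i \<le> N" "I i s'" "reg s' x = i" "reg s' g = N - i" "frame ?R ?A s s'" for i s' t
    using that
  proof (induction "N - i" arbitrary: i s' t)
    case 0
    then show ?case by (intro wp_While_False) auto
  next
    case (Suc d)
    then have iN: "i < N" by simp
    show ?case
    proof (rule wp_While_True)
      show "reg s' g \<noteq> 0" using Suc.prems iN by simp
      note b = body[OF iN Suc.prems(2,3,5), of "t + 1"]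
      show "wp (Seq P (Seq (Add x x 1) (Sub g b x))) (wp ?W
        (\<lambda>s' t'. I N s' \<and> frame ?R ?A s s' \<and> t' \<le> t + 1 + (N - i) * (B + 3))) s' (t + 1)"
        unfolding wp_Seq
      proof (rule wp_conseq[OF b], goal_cases)
        case (1 s1 t1)
        have fr: "frame ?R ?A s s1"
          using Suc.prems(5) 1(2) by (auto simp: frame_def)
        have r: "reg s1 1 = 1" "reg s1 b = N" "reg s1 x = i"
          using frame_reg[OF 1(2), of x] frame_reg[OF 1(2), of b] frame_reg[OF 1(2), of 1]
            frame_reg[OF Suc.prems(5), of b] frame_reg[OF Suc.prems(5), of 1] disj regs Suc.prems(3)
          by auto
        let ?s2 = "s1\<lparr>reg := (reg s1)(x := Suc i, g := N - Suc i)\<rparr>"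
        have "wp ?W (\<lambda>s' t'. I N s' \<and> frame ?R ?A s s' \<and> t' \<le> (t1 + 2) + 1 + (N - Suc i) * (B + 3))
          ?s2 (t1 + 2)"
        proof (rule Suc.hyps(1))
          show "d = N - Suc i" "Suc i \<le> N" using Suc.hyps(2) by auto
          show "frame ?R ?A s ?s2" using fr by (auto simp: frame_def)
          show "I (Suc i) ?s2" using 1(1) by simp
        qed (use regs in auto)
        moreover have "(t1 + 2) + 1 + (N - Suc i) * (B + 3) \<le> t + 1 + (N - i) * (B + 3)"
        proof -
          have "N - i = Suc (N - Suc i)" using iN by simp
          then have "(N - i) * (B + 3) = (N - Suc i) * (B + 3) + (B + 3)" by simp
          then show ?thesis using 1(1) by linarith
        qed
        ultimately have "wp ?W
          (\<lambda>s' t'. I N s' \<and> frame ?R ?A s s' \<and> t' \<le> t + 1 + (N - i) * (B + 3)) ?s2 (t1 + 2)"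
          by (elim wp_mono) auto
        then show ?case using r regs by (simp add: fun_upd_def[symmetric])
      qed
    qed
  qed
  let ?s1 = "s\<lparr>reg := (reg s)(x := 0, g := N)\<rparr>"
  have "wp ?W (\<lambda>s' t'. I N s' \<and> frame ?R ?A s s' \<and> t' \<le> (t + 2) + 1 + (N - 0) * (B + 3)) ?s1 (t + 2)"
    by (rule loop) (use init regs in \<open>auto simp: frame_def\<close>)
  then show ?thesis using regs by (simp add: for_loop_def eval_nat_numeral)
qed

text \<open>
  Programs are executed repeatedly with an overhead that is independent of the program.  To this
  end register \<open>x\<close> of the simulated program lives in array \<open>5 + 2 * x\<close> at the base address (held
  in register 2), and its array \<open>a\<close> lives in array \<open>6 + 2 * a\<close>, shifted by the base address.
  Register 3 holds an address from which on all these arrays are still zero, so that the next run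
  gets a fresh store by just moving the base address there.
\<close>

primrec relocate :: "com \<Rightarrow> com" where
  "relocate Skip = Skip"
| "relocate (Const x c) = Seq (Const 4 c) (Store (5 + 2 * x) 2 4)"
| "relocate (Add x y z) = Seq (Load 4 (5 + 2 * y) 2) (Seq (Load 5 (5 + 2 * z) 2)
     (Seq (Add 4 4 5) (Store (5 + 2 * x) 2 4)))"
| "relocate (Sub x y z) = Seq (Load 4 (5 + 2 * y) 2) (Seq (Load 5 (5 + 2 * z) 2)
     (Seq (Sub 4 4 5) (Store (5 + 2 * x) 2 4)))"
| "relocate (Load x a y) = Seq (Load 4 (5 + 2 * y) 2) (Seq (Add 4 4 2)
     (Seq (Load 4 (6 + 2 * a) 4) (Store (5 + 2 * x) 2 4)))"
| "relocate (Store a x y) = Seq (Load 4 (5 + 2 * x) 2) (Seq (Add 4 4 2)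
     (Seq (Load 5 (5 + 2 * y) 2) (Seq (Store (6 + 2 * a) 4 5)
     (Seq (Add 4 4 1) (Seq (Sub 4 4 3) (Add 3 3 4))))))"
| "relocate (Seq P Q) = Seq (relocate P) (relocate Q)"
| "relocate (IfNZ x P Q) = Seq (Load 4 (5 + 2 * x) 2) (IfNZ 4 (relocate P) (relocate Q))"
| "relocate (WhileNZ x P) = Seq (Load 4 (5 + 2 * x) 2)
     (WhileNZ 4 (Seq (relocate P) (Load 4 (5 + 2 * x) 2)))"

lemma written_regs_relocate: "written_regs (relocate P) \<subseteq> {3, 4, 5}"
  by (induction P) auto

lemma written_arrs_relocate: "written_arrs (relocate P) \<subseteq> {5..}"
  by (induction P) auto

text \<open>Simulated registers are written at the base address itself; the strict inequality keeps
  these cells below the region that has to stay zero.\<close>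

definition relocated :: "store \<Rightarrow> store \<Rightarrow> bool" where
  "relocated s h \<longleftrightarrow> reg h 1 = 1 \<and> reg h 2 < reg h 3 \<and>
     (\<forall>x. arr h (5 + 2 * x) (reg h 2) = reg s x) \<and>
     (\<forall>a i. arr h (6 + 2 * a) (reg h 2 + i) = arr s a i) \<and>
     (\<forall>a\<ge>5. \<forall>i\<ge>reg h 3. arr h a i = 0)"

lemma array_parity [simp]:
  "5 + 2 * x \<noteq> 6 + 2 * (y::nat)" "6 + 2 * y \<noteq> 5 + 2 * (x::nat)"
  by presburger+

text \<open>No step is replaced by more than 7 steps, the length of the translated
  \<open>Store\<close>, and a test costs one more load. The factor 8 is therefore valid for all
  programs alike.\<close>

lemma relocate_exec:
  "exec P s k s' \<Longrightarrow> relocated s h \<Longrightarrow>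
     \<exists>k' h'. exec (relocate P) h k' h' \<and> relocated s' h' \<and> k' \<le> 8 * k"
proof (induction arbitrary: h rule: exec.induct)
  case (Skip s)
  have "wp (relocate Skip) (\<lambda>h' t. relocated s h' \<and> t \<le> 8) h 0"
    using Skip by simp
  then show ?case by (simp add: wp_def)
next
  case (Const x c s)
  have "wp (relocate (Const x c)) (\<lambda>h' t. relocated (s\<lparr>reg := (reg s)(x := c)\<rparr>) h' \<and> t \<le> 8) h 0"
    using Const by (auto simp: relocated_def)
  then show ?case by (simp add: wp_def del: relocate.simps)
next
  case (Add x y z s)
  have "wp (relocate (Add x y z))
    (\<lambda>h' t. relocated (s\<lparr>reg := (reg s)(x := reg s y + reg s z)\<rparr>) h' \<and> t \<le> 8) h 0"
    using Add by (auto simp: relocated_def)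
  then show ?case by (simp add: wp_def del: relocate.simps)
next
  case (Sub x y z s)
  have "wp (relocate (Sub x y z))
    (\<lambda>h' t. relocated (s\<lparr>reg := (reg s)(x := reg s y - reg s z)\<rparr>) h' \<and> t \<le> 8) h 0"
    using Sub by (auto simp: relocated_def)
  then show ?case by (simp add: wp_def del: relocate.simps)
next
  case (Load x a y s)
  have "wp (relocate (Load x a y))
    (\<lambda>h' t. relocated (s\<lparr>reg := (reg s)(x := arr s a (reg s y))\<rparr>) h' \<and> t \<le> 8) h 0"
    using Load by (auto simp: relocated_def add.commute)
  then show ?case by (simp add: wp_def del: relocate.simps)
next
  \<comment> \<open>Register 3 grows by the truncated difference of the successor of the written
    address and itself, so it becomes the maximum of the two, and no cell from register 3 on has
    been touched.\<close>
  case (Store a x y s)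
  have "wp (relocate (Store a x y))
    (\<lambda>h' t. relocated (s\<lparr>arr := (arr s)(a := (arr s a)(reg s x := reg s y))\<rparr>) h' \<and> t \<le> 8) h 0"
    using Store by (auto simp: relocated_def add.commute)
  then show ?case by (simp add: wp_def del: relocate.simps)
next
  case (Seq P s k s' Q l s'')
  from Seq.IH(1)[OF Seq.prems] obtain k1 h1
    where 1: "exec (relocate P) h k1 h1" "relocated s' h1" "k1 \<le> 8 * k" by blast
  from Seq.IH(2)[OF 1(2)] obtain k2 h2
    where 2: "exec (relocate Q) h1 k2 h2" "relocated s'' h2" "k2 \<le> 8 * l" by blast
  from 1 2 show ?case
    by (intro exI[of _ "k1 + k2"] exI[of _ h2]) (auto intro: exec.intros)
next
  case (IfTrue s x P k s' Q)
  let ?h = "h\<lparr>reg := (reg h)(4 := reg s x)\<rparr>"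
  have "relocated s ?h" using IfTrue.prems by (simp add: relocated_def)
  from IfTrue.IH[OF this] obtain k1 h1
    where 1: "exec (relocate P) ?h k1 h1" "relocated s' h1" "k1 \<le> 8 * k" by blast
  have "exec (Load 4 (5 + 2 * x) 2) h 1 ?h"
    using IfTrue.prems exec.Load[of 4 "5 + 2 * x" 2 h] by (simp add: relocated_def)
  moreover have "exec (IfNZ 4 (relocate P) (relocate Q)) ?h (k1 + 1) h1"
    by (rule exec.IfTrue) (use IfTrue.hyps 1 in auto)
  ultimately have "exec (relocate (IfNZ x P Q)) h (1 + (k1 + 1)) h1"
    by (simp add: exec.Seq del: One_nat_def)
  with 1 show ?case by (intro exI[of _ "1 + (k1 + 1)"] exI[of _ h1]) simp
next
  case (IfFalse s x Q k s' P)
  let ?h = "h\<lparr>reg := (reg h)(4 := reg s x)\<rparr>"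
  have "relocated s ?h" using IfFalse.prems by (simp add: relocated_def)
  from IfFalse.IH[OF this] obtain k1 h1
    where 1: "exec (relocate Q) ?h k1 h1" "relocated s' h1" "k1 \<le> 8 * k" by blast
  have "exec (Load 4 (5 + 2 * x) 2) h 1 ?h"
    using IfFalse.prems exec.Load[of 4 "5 + 2 * x" 2 h] by (simp add: relocated_def)
  moreover have "exec (IfNZ 4 (relocate P) (relocate Q)) ?h (k1 + 1) h1"
    by (rule exec.IfFalse) (use IfFalse.hyps 1 in auto)
  ultimately have "exec (relocate (IfNZ x P Q)) h (1 + (k1 + 1)) h1"
    by (simp add: exec.Seq del: One_nat_def)
  with 1 show ?case by (intro exI[of _ "1 + (k1 + 1)"] exI[of _ h1]) simp
next
  case (WhileFalse s x P)
  have "wp (relocate (WhileNZ x P)) (\<lambda>h' t. relocated s h' \<and> t \<le> 8) h 0"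
    using WhileFalse by (auto simp: relocated_def intro!: wp_While_False)
  then show ?case by (simp add: wp_def del: relocate.simps)
next
  case (WhileTrue s x P k s' l s'')
  let ?h = "h\<lparr>reg := (reg h)(4 := reg s x)\<rparr>"
  let ?W = "WhileNZ 4 (Seq (relocate P) (Load 4 (5 + 2 * x) 2))"
  have "relocated s ?h" using WhileTrue.prems by (simp add: relocated_def)
  from WhileTrue.IH(1)[OF this] obtain k1 h1
    where 1: "exec (relocate P) ?h k1 h1" "relocated s' h1" "k1 \<le> 8 * k" by blast
  from WhileTrue.IH(2)[OF 1(2)] obtain k2 h2
    where 2: "exec (relocate (WhileNZ x P)) h1 k2 h2" "relocated s'' h2" "k2 \<le> 8 * l" by blast
  \<comment> \<open>The load with which the remaining run begins is the same as the load that ends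
    the loop body in the present round.\<close>
  from 2(1) obtain k3 h3 k4 where 3: "exec (Load 4 (5 + 2 * x) 2) h1 k3 h3"
      "exec ?W h3 k4 h2" "k2 = k3 + k4"
    unfolding relocate.simps by (elim exec_SeqE) blast
  have "exec (Load 4 (5 + 2 * x) 2) h 1 ?h"
    using WhileTrue.prems exec.Load[of 4 "5 + 2 * x" 2 h] by (simp add: relocated_def)
  moreover have "exec ?W ?h ((k1 + k3) + k4 + 1) h2"
    by (rule exec.WhileTrue) (use WhileTrue.hyps 1 3 in \<open>auto intro: exec.Seq\<close>)
  ultimately have "exec (relocate (WhileNZ x P)) h (1 + ((k1 + k3) + k4 + 1)) h2"
    by (simp add: exec.Seq del: One_nat_def)
  with 1 2 3 show ?case by (intro exI[of _ "1 + ((k1 + k3) + k4 + 1)"] exI[of _ h2]) simp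
qed

lemma wp_relocate:
  assumes "exec P s k s'" "relocated s h"
  shows "wp (relocate P) (\<lambda>h' t'. relocated s' h' \<and> t' \<le> t + 8 * k) h t"
  using relocate_exec[OF assms] unfolding wp_def by auto

section \<open>The length of an output is bounded by the running time\<close>

lemma exec_writes_bounded:
  "exec P s k s' \<Longrightarrow> finite {i. arr s' a i \<noteq> arr s a i} \<and> card {i. arr s' a i \<noteq> arr s a i} \<le> k"
proof (induction rule: exec.induct)
  case (Store b x y s)
  let ?D = "{i. arr (s\<lparr>arr := (arr s)(b := (arr s b)(reg s x := reg s y))\<rparr>) a i \<noteq> arr s a i}"
  have "?D \<subseteq> {reg s x}" by auto
  then show ?case using card_mono[of "{reg s x}" ?D] finite_subset[of ?D "{reg s x}"] by simp
next
  case (Seq P s k s' Q l s'')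
  let ?D = "{i. arr s'' a i \<noteq> arr s a i}"
  have "?D \<subseteq> {i. arr s' a i \<noteq> arr s a i} \<union> {i. arr s'' a i \<noteq> arr s' a i}" (is "_ \<subseteq> ?A \<union> ?B")
    by auto
  then have "finite ?D" "card ?D \<le> card (?A \<union> ?B)"
    using Seq.IH by (auto intro: finite_subset card_mono)
  then show ?case using Seq.IH card_Un_le[of ?A ?B] by linarith
next
  case (WhileTrue s x P k s' l s'')
  let ?D = "{i. arr s'' a i \<noteq> arr s a i}"
  have "?D \<subseteq> {i. arr s' a i \<noteq> arr s a i} \<union> {i. arr s'' a i \<noteq> arr s' a i}" (is "_ \<subseteq> ?A \<union> ?B")
    by auto
  then have "finite ?D" "card ?D \<le> card (?A \<union> ?B)"
    using WhileTrue.IH by (auto intro: finite_subset card_mono)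
  then show ?case using WhileTrue.IH card_Un_le[of ?A ?B] by linarith
qed auto

text \<open>The value of register 0 alone is no measure of time. But array 1 is initially zero, so
  each nonempty listed set needs a write in its own block, and each step writes at most one cell. By
  distinctness at most one listed set is empty, which accounts for the additional 1.\<close>

lemma distinct_listed_sets_bound:
  assumes "exec P (input_store G) k s" "distinct (listed_sets n s)"
  shows "reg s 0 \<le> k + 1"
proof -
  let ?L = "\<lambda>i. {v. v < n \<and> arr s 1 (i * n + v) \<noteq> 0}"
  let ?N = "{i. i < reg s 0 \<and> ?L i \<noteq> {}}"
  let ?D = "{i. arr s 1 i \<noteq> arr (input_store G) 1 i}"
  have inj: "inj_on ?L {..<reg s 0}"
    using assms(2) by (simp add: listed_sets_def distinct_map lessThan_atLeast0)
  have D: "finite ?D" "card ?D \<le> k" using exec_writes_bounded[OF assms(1)] by blast+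
  have "card ?N \<le> card ?D"
  proof (rule card_inj_on_le[OF _ _ D(1)])
    \<comment> \<open>A nonzero cell in block \<open>i\<close>; since blocks have length
      \<open>n\<close>, division by \<open>n\<close> recovers \<open>i\<close>.\<close>
    let ?f = "\<lambda>i. i * n + (SOME v. v \<in> ?L i)"
    have sel: "(SOME v. v \<in> ?L i) \<in> ?L i" if "i \<in> ?N" for i
      using that some_in_eq[of "?L i"] by blast
    show "inj_on ?f ?N"
    proof (rule inj_onI)
      fix i j assume "i \<in> ?N" "j \<in> ?N" "?f i = ?f j"
      then have "?f i div n = ?f j div n" "(SOME v. v \<in> ?L i) < n" "(SOME v. v \<in> ?L j) < n"
        using sel by auto
      then show "i = j" by auto
    qed
    show "?f ` ?N \<subseteq> ?D"
      using sel by (auto simp: input_store_def Let_def)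
  qed
  moreover have "card {i. i < reg s 0 \<and> ?L i = {}} \<le> 1"
  proof -
    have "card {i. i < reg s 0 \<and> ?L i = {}} \<le> card {{}::nat set}"
    proof (rule card_inj_on_le[of ?L])
      show "inj_on ?L {i. i < reg s 0 \<and> ?L i = {}}" by (rule inj_on_subset[OF inj]) auto
    qed auto
    then show ?thesis by simp
  qed
  moreover have "reg s 0 = card ?N + card {i. i < reg s 0 \<and> ?L i = {}}"
  proof -
    have "{..<reg s 0} = ?N \<union> {i. i < reg s 0 \<and> ?L i = {}}" by auto
    then have "card {..<reg s 0} = card (?N \<union> {i. i < reg s 0 \<and> ?L i = {}})" by simp
    also have "\<dots> = card ?N + card {i. i < reg s 0 \<and> ?L i = {}}"
      by (rule card_Un_disjoint) auto
    finally show ?thesis by simp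
  qed
  ultimately show ?thesis using D(2) by linarith
qed

section \<open>Enumeration of small subsets\<close>

definition small_subsets :: "nat \<Rightarrow> nat \<Rightarrow> nat set \<Rightarrow> nat set set" where
  "small_subsets b q C = {F \<union> C |F. F \<subseteq> {..<b} \<and> card F \<le> q}"

lemma small_subsets_0 [simp]: "small_subsets b 0 C = {C}"
proof -
  have "F = {}" if "F \<subseteq> {..<b}" "card F = 0" for F :: "nat set"
    using that finite_subset[OF that(1)] by simp
  then have "F \<subseteq> {..<b} \<and> card F \<le> 0 \<longleftrightarrow> F = {}" for F :: "nat set" by auto
  then show ?thesis by (simp add: small_subsets_def)
qed

text \<open>A nonempty chosen set is split at its largest element \<open>x\<close>; the rest lies
  below \<open>x\<close>. This is the recursion that the nested loops follow.\<close>

lemma small_subsets_Suc: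
  "small_subsets b (Suc q) C = {C} \<union> (\<Union>x<b. small_subsets x q (insert x C))"
proof (intro equalityI subsetI)
  fix E assume "E \<in> small_subsets b (Suc q) C"
  then obtain F where F: "E = F \<union> C" "F \<subseteq> {..<b}" "card F \<le> Suc q"
    by (auto simp: small_subsets_def)
  have fin: "finite F" using F(2) finite_subset by blast
  show "E \<in> {C} \<union> (\<Union>x<b. small_subsets x q (insert x C))"
  proof (cases "F = {}")
    case False
    define x where "x = Max F"
    have x: "x \<in> F" "\<And>y. y \<in> F \<Longrightarrow> y \<le> x" using False fin by (auto simp: x_def)
    have "E = (F - {x}) \<union> insert x C" "F - {x} \<subseteq> {..<x}" "card (F - {x}) \<le> q"
      using F x fin by (auto simp: le_less)
    then have "E \<in> small_subsets x q (insert x C)" unfolding small_subsets_def by blast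
    then show ?thesis using x(1) F(2) by auto
  qed (use F in auto)
next
  fix E assume E: "E \<in> {C} \<union> (\<Union>x<b. small_subsets x q (insert x C))"
  show "E \<in> small_subsets b (Suc q) C"
  proof (cases "E = C")
    case True
    then show ?thesis unfolding small_subsets_def by (intro CollectI exI[of _ "{}"]) auto
  next
    case False
    with E obtain x F where F: "x < b" "E = F \<union> insert x C" "F \<subseteq> {..<x}" "card F \<le> q"
      by (auto simp: small_subsets_def)
    have "E = insert x F \<union> C" "insert x F \<subseteq> {..<b}" "card (insert x F) \<le> Suc q"
      using F finite_subset[OF F(3)] by (auto simp: card_insert_if)
    then show ?thesis unfolding small_subsets_def by blast
  qed
qed

lemma small_subsets_mem: "E \<in> small_subsets b q C \<Longrightarrow> C \<subseteq> E \<and> E \<subseteq> {..<b} \<union> C"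
  by (auto simp: small_subsets_def)

text \<open>The number \<open>y\<close> separates the two families: it belongs to every set of the
  second and to no set of the first.\<close>

lemma small_subsets_disjoint:
  assumes "x < y" "C \<inter> {..<b} = {}" "y < b"
  shows "small_subsets x q (insert x C) \<inter> small_subsets y q (insert y C) = {}"
  using assms by (auto dest!: small_subsets_mem)

definition ind :: "nat set \<Rightarrow> nat \<Rightarrow> nat" where
  "ind C i = (if i \<in> C then 1 else 0)"

lemma ind_insert: "(ind C)(x := 1) = ind (insert x C)"
  by (auto simp: ind_def)

lemma ind_remove: "x \<notin> C \<Longrightarrow> (ind (insert x C))(x := 0) = ind C"
  by (auto simp: ind_def)

text \<open>
  Runs \<open>P\<close> for each set of at most \<open>q\<close> numbers below register \<open>40 + 2 * q\<close>, the set being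
  given by its characteristic function in array 2.  Elements are chosen in decreasing order, so that
  no set occurs twice.
\<close>

primrec for_subsets :: "nat \<Rightarrow> com \<Rightarrow> com" where
  "for_subsets 0 P = P"
| "for_subsets (Suc q) P = Seq P (for_loop (40 + 2 * q) (41 + 2 * q) (42 + 2 * q)
     (Seq (Store 2 (40 + 2 * q) 1) (Seq (for_subsets q P) (Seq (Const 4 0) (Store 2 (40 + 2 * q) 4)))))"

lemma written_regs_for_subsets: "written_regs (for_subsets q P) \<subseteq> written_regs P \<union> {4} \<union> {40..<40 + 2 * q}"
  by (induction q) auto

lemma written_arrs_for_subsets: "written_arrs (for_subsets q P) \<subseteq> written_arrs P \<union> {2}"
  by (induction q) auto

primrec subsets_time :: "nat \<Rightarrow> nat \<Rightarrow> nat \<Rightarrow> nat" where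
  "subsets_time n B 0 = B"
| "subsets_time n B (Suc q) = B + 3 + n * (subsets_time n B q + 6)"

text \<open>With 6 added to both sides the recurrence reads \<open>B + 9 + n * U\<close> for the
  previous value \<open>U\<close>. As \<open>B + 9\<close> is at most twice \<open>B + 6\<close>,
  raising the factor from \<open>n\<close> to \<open>n + 2\<close> absorbs the constant
  summand.\<close>

lemma subsets_time_bound: "subsets_time n B q + 6 \<le> (B + 6) * (n + 2) ^ q"
proof (induction q)
  case (Suc q)
  have "subsets_time n B (Suc q) + 6 \<le> B + 9 + n * ((B + 6) * (n + 2) ^ q)"
    using mult_le_mono2[OF Suc, of n] by simp
  also have "B + 9 \<le> 2 * (B + 6) * (n + 2) ^ q"
  proof -
    have "B + 9 \<le> 2 * (B + 6) * 1" by simp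
    also have "\<dots> \<le> 2 * (B + 6) * (n + 2) ^ q" by (rule mult_le_mono2) simp
    finally show ?thesis .
  qed
  finally show ?case by (simp add: algebra_simps)
qed simp

text \<open>The invariant is indexed by the family \<open>E\<close> of sets already visited. That no
  set is visited twice thus reaches the body as \<open>C \<notin> E\<close>, on which the
  distinctness of the final list rests. The condition \<open>C \<subseteq> {b..<n}\<close> records
  that all elements still to be chosen are smaller than those in \<open>C\<close>; the loop counter
  of one level serves as the bound \<open>b\<close> of the next.\<close>

lemma wp_for_subsets:
  fixes Inv :: "nat set set \<Rightarrow> store \<Rightarrow> bool"
  assumes body: "\<And>E C s t. Inv E s \<Longrightarrow> arr s 2 = ind C \<Longrightarrow> C \<subseteq> {..<n} \<Longrightarrow> card C \<le> Q \<Longrightarrow>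
      C \<notin> E \<Longrightarrow> reg s 1 = 1 \<Longrightarrow> wp P (\<lambda>s' t'. Inv (insert C E) s' \<and> t' \<le> t + B) s t"
    and wr: "1 \<notin> written_regs P" "written_regs P \<inter> {40..} = {}" "2 \<notin> written_arrs P"
    and stable: "\<And>E s s'. Inv E s \<Longrightarrow> frame ({4} \<union> {40..}) {2} s s' \<Longrightarrow> Inv E s'"
  shows "Inv E s \<Longrightarrow> arr s 2 = ind C \<Longrightarrow> C \<subseteq> {b..<n} \<Longrightarrow> b \<le> n \<Longrightarrow> card C + q \<le> Q \<Longrightarrow>
    E \<inter> small_subsets b q C = {} \<Longrightarrow> reg s 1 = 1 \<Longrightarrow> reg s (40 + 2 * q) = b \<Longrightarrow>
    wp (for_subsets q P) (\<lambda>s' t'. Inv (E \<union> small_subsets b q C) s' \<and> arr s' 2 = ind C \<and>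
      t' \<le> t + subsets_time n B q) s t"
proof (induction q arbitrary: E s C b t)
  case 0
  have "C \<subseteq> {..<n}" using 0 by auto
  then show ?case using 0 wr
    by (auto intro!: wp_conseq[OF body[of E s C t]] simp: frame_arr)
next
  case (Suc q)
  let ?S = "\<lambda>x. small_subsets x q (insert x C)"
  let ?x = "40 + 2 * q" and ?g = "41 + 2 * q" and ?b = "42 + 2 * q"
  let ?P = "Seq (Store 2 ?x 1) (Seq (for_subsets q P) (Seq (Const 4 0) (Store 2 ?x 4)))"
  have wrq: "written_regs (for_subsets q P) \<subseteq> - ({1} \<union> {?x..})"
    using written_regs_for_subsets[of q P] wr by fastforce
  have C: "C \<subseteq> {..<n}" "finite C" "C \<inter> {..<b} = {}" using Suc.prems by (auto intro: finite_subset)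
  have bP: "?b \<notin> written_regs P" using wr(2) by (auto simp: disjoint_iff)
  have CE: "C \<notin> E" using Suc.prems by (auto simp: small_subsets_Suc)
  have "wp P (\<lambda>s' t'. Inv (insert C E) s' \<and> t' \<le> t + B) s t"
    by (rule body) (use Suc.prems C CE in auto)
  then show ?case unfolding for_subsets.simps wp_Seq
  proof (rule wp_conseq, goal_cases)
    case (1 s1 t1)
    let ?I = "\<lambda>i s'. Inv (insert C E \<union> (\<Union>x<i. ?S x)) s' \<and> arr s' 2 = ind C"
    have regs: "reg s1 1 = 1" "reg s1 ?b = b" "arr s1 2 = ind C"
      using frame_reg[OF 1(2), of 1] frame_reg[OF 1(2), of ?b] frame_arr[OF 1(2), of 2] wr bP Suc.prems
      by auto
    have "wp (for_loop ?x ?g ?b ?P)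
       (\<lambda>s' t'. ?I b s' \<and> frame ({?x, ?g} \<union> written_regs ?P) (written_arrs ?P) s1 s' \<and>
         t' \<le> t1 + 3 + b * ((subsets_time n B q + 3) + 3)) s1 t1"
    proof (rule wp_for_loop)
      show "reg s1 1 = 1" "reg s1 ?b = b" by fact+
      show "?x \<notin> written_regs ?P" "?b \<notin> written_regs ?P" "1 \<notin> written_regs ?P"
        using wrq by auto
      show "?I 0 (s1\<lparr>reg := (reg s1)(?x := 0, ?g := b)\<rparr>)"
        using stable[of "insert C E" s1 "s1\<lparr>reg := (reg s1)(?x := 0, ?g := b)\<rparr>"] 1 regs
        by (simp add: frame_def)
    next
      fix i s2 t2
      assume i: "i < b" and I: "?I i s2" and x: "reg s2 ?x = i"
        and fr: "frame ({?x, ?g} \<union> written_regs ?P) (written_arrs ?P) s1 s2"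
      have one: "reg s2 1 = 1" using frame_reg[OF fr, of 1] wrq regs by auto
      let ?s3 = "s2\<lparr>arr := (arr s2)(2 := (arr s2 2)(i := 1))\<rparr>"
      have inv3: "Inv (insert C E \<union> (\<Union>x<i. ?S x)) ?s3"
        using stable[of _ s2 ?s3] I by (simp add: frame_def)
      have iC: "i \<notin> C" using i Suc.prems by auto
      have "wp (for_subsets q P) (\<lambda>s' t'. Inv ((insert C E \<union> (\<Union>x<i. ?S x)) \<union> ?S i) s' \<and>
          arr s' 2 = ind (insert i C) \<and> t' \<le> (t2 + 1) + subsets_time n B q) ?s3 (t2 + 1)"
      proof (rule Suc.IH[OF inv3])
        show "arr ?s3 2 = ind (insert i C)" using I by (simp add: ind_insert[symmetric])
        show "insert i C \<subseteq> {i..<n}" "i \<le> n" using i Suc.prems by auto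
        show "card (insert i C) + q \<le> Q" using Suc.prems C iC by simp
        have "?S i \<subseteq> small_subsets b (Suc q) C - {C}"
          using i iC by (auto simp: small_subsets_Suc dest: small_subsets_mem)
        moreover have "?S j \<inter> ?S i = {}" if "j < i" for j
          by (rule small_subsets_disjoint[OF that C(3) i])
        ultimately show "(insert C E \<union> (\<Union>x<i. ?S x)) \<inter> ?S i = {}"
          using Suc.prems by blast
      qed (use one x in auto)
      then show "wp ?P (\<lambda>s'' t'. ?I (Suc i) (s''\<lparr>reg := (reg s'')(?x := Suc i, ?g := b - Suc i)\<rparr>) \<and>
         t' \<le> t2 + (subsets_time n B q + 3)) s2 t2"
        unfolding wp_Seq wp_Store x one
      proof (rule wp_conseq, goal_cases)
        case (1 s4 t4)
        have x4: "reg s4 ?x = i" using frame_reg[OF 1(2), of ?x] wrq x by auto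
        let ?s5 = "s4\<lparr>arr := (arr s4)(2 := (arr s4 2)(i := 0)),
          reg := (reg s4)(4 := 0, ?x := Suc i, ?g := b - Suc i)\<rparr>"
        have "Inv ((insert C E \<union> (\<Union>x<i. ?S x)) \<union> ?S i) ?s5"
          using stable[of _ s4 ?s5] 1 by (simp add: frame_def)
        moreover have "(insert C E \<union> (\<Union>x<i. ?S x)) \<union> ?S i = insert C E \<union> (\<Union>x<Suc i. ?S x)"
          by (auto simp: lessThan_Suc)
        ultimately have "Inv (insert C E \<union> (\<Union>x<Suc i. ?S x)) ?s5" by simp
        then show ?case using x4 1(1) ind_remove[OF iC] by simp
      qed
    qed auto
    then show ?case
    proof (rule wp_mono, goal_cases)
      case (1 s' t')
      have "b * ((subsets_time n B q + 3) + 3) \<le> n * (subsets_time n B q + 6)"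
        using mult_le_mono1[OF \<open>b \<le> n\<close>, of "subsets_time n B q + 6"] by (simp add: add.assoc)
      then have "t' \<le> t + subsets_time n B (Suc q)" using 1 \<open>_ \<and> t1 \<le> t + B\<close>
        unfolding subsets_time.simps by linarith
      moreover have "insert C E \<union> (\<Union>x<b. ?S x) = E \<union> small_subsets b (Suc q) C"
        by (auto simp: small_subsets_Suc)
      ultimately show ?case using 1 by simp
    qed
  qed
qed

section \<open>Induced subgraphs on an initial segment\<close>

definition rank :: "nat set \<Rightarrow> nat \<Rightarrow> nat" where
  "rank Y u = card {v\<in>Y. v < u}"

lemma rank_0 [simp]: "rank Y 0 = 0"
  by (simp add: rank_def)

lemma rank_Suc: "rank Y (Suc u) = rank Y u + (if u \<in> Y then 1 else 0)"
proof -
  have "{v\<in>Y. v < Suc u} = (if u \<in> Y then insert u {v\<in>Y. v < u} else {v\<in>Y. v < u})"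
    by (auto simp: less_Suc_eq)
  then show ?thesis by (simp add: rank_def)
qed

lemma rank_full: "Y \<subseteq> {..<n} \<Longrightarrow> rank Y n = card Y"
  unfolding rank_def by (rule arg_cong[where f = card]) auto

lemma rank_less:
  assumes "u \<in> Y" "u < v"
  shows "rank Y u < rank Y v"
  unfolding rank_def by (rule psubset_card_mono) (use assms in auto)

lemma inj_on_rank: "inj_on (rank Y) Y"
proof (rule inj_onI)
  fix u v assume "u \<in> Y" "v \<in> Y" "rank Y u = rank Y v"
  then show "u = v" using rank_less[of u Y v] rank_less[of v Y u] by (cases u v rule: linorder_cases) auto
qed

lemma bij_betw_rank:
  assumes "finite Y"
  shows "bij_betw (rank Y) Y {..<card Y}"
proof -
  have sub: "rank Y ` Y \<subseteq> {..<card Y}"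
  proof
    fix r assume "r \<in> rank Y ` Y"
    then obtain u where u: "u \<in> Y" "r = rank Y u" by auto
    have "{v\<in>Y. v < u} \<subset> Y" using u by auto
    then show "r \<in> {..<card Y}" using u psubset_card_mono[OF assms] by (simp add: rank_def)
  qed
  have "rank Y ` Y = {..<card Y}"
    by (rule card_subset_eq[OF _ sub]) (auto simp: card_image[OF inj_on_rank])
  then show ?thesis using inj_on_rank by (simp add: bij_betw_def)
qed

text \<open>The given programs accept only vertex sets of the form \<open>{..<m}\<close>, so induced
  subgraphs have to be relabelled. Since \<open>rank\<close> preserves the order, a row by row scan
  of the large matrix meets the entries of the small one in their correct order.\<close>

definition compress :: "ngraph \<Rightarrow> nat set \<Rightarrow> ngraph" where
  "compress G Y = \<lparr>pverts = {..<card Y},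
     parcs = {(rank Y u, rank Y v) |u v. u \<in> Y \<and> v \<in> Y \<and> (u, v) \<in> parcs G}\<rparr>"

lemma pair_graph_iff:
  "pair_graph G \<longleftrightarrow> finite (pverts G) \<and> parcs G \<subseteq> pverts G \<times> pverts G \<and>
     sym (parcs G) \<and> irrefl (parcs G)" (is "_ \<longleftrightarrow> ?R")
proof
  assume "pair_graph G"
  then interpret pair_graph G .
  have "(v, v) \<notin> parcs G" for v using pair_no_loops[of "(v, v)"] by auto
  then show ?R using pair_finite_verts pair_sym_arcs
    by (auto simp: symmetric_def irrefl_def dest: wellformed')
next
  assume R: ?R
  then have "finite (parcs G)" using finite_subset by blast
  with R show "pair_graph G"
    by unfold_locales (auto simp: symmetric_def irrefl_def)
qed

lemma pair_graph_induced: "pair_graph G \<Longrightarrow> A \<subseteq> pverts G \<Longrightarrow> pair_graph (induced G A)"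
  unfolding pair_graph_iff induced_def
  by (auto simp: sym_def irrefl_def intro: finite_subset)

lemma induced_induced: "A \<subseteq> B \<Longrightarrow> induced (induced G B) A = induced G A"
  by (auto simp: induced_def)

lemma compress_arc_iff:
  assumes "u \<in> Y" "v \<in> Y"
  shows "(rank Y u, rank Y v) \<in> parcs (compress G Y) \<longleftrightarrow> (u, v) \<in> parcs G"
  using assms inj_on_rank[of Y] by (auto simp: compress_def dest: inj_onD)

lemma pair_graph_compress:
  assumes "pair_graph G" "finite Y"
  shows "pair_graph (compress G Y)"
proof -
  have "rank Y u < card Y" if "u \<in> Y" for u
    using bij_betw_rank[OF assms(2)] that by (auto simp: bij_betw_def)
  moreover have "u = v" if "rank Y u = rank Y v" "u \<in> Y" "v \<in> Y" for u v
    using inj_onD[OF inj_on_rank] that by blast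
  moreover have G: "sym (parcs G)" "irrefl (parcs G)" using assms(1) by (auto simp: pair_graph_iff)
  moreover have "sym (parcs (compress G Y))"
    using symD[OF G(1)] by (fastforce simp: compress_def intro: symI)
  moreover have "irrefl (parcs (compress G Y))"
    using calculation(2) G(2) by (fastforce simp: compress_def irrefl_def)
  ultimately show ?thesis by (auto simp: pair_graph_iff compress_def)
qed

lemma compress_iso:
  assumes "pair_graph G" "Y \<subseteq> pverts G"
  shows "digraph_iso (with_proj (induced G Y)) (with_proj (compress G Y))"
proof -
  have fin: "finite Y" using assms by (auto simp: pair_graph_iff intro: finite_subset)
  interpret I: pair_graph "induced G Y" using pair_graph_induced[OF assms] .
  define f :: "(nat, nat \<times> nat, nat, nat \<times> nat) digraph_isomorphism" where
    "f = \<lparr>iso_verts = rank Y, iso_arcs = map_prod (rank Y) (rank Y),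
      iso_head = snd, iso_tail = fst\<rparr>"
  have sub: "parcs (induced G Y) \<subseteq> Y \<times> Y" by (auto simp: induced_def)
  have "inj_on (map_prod (rank Y) (rank Y)) (parcs (induced G Y))"
    by (rule inj_on_subset[OF map_prod_inj_on[OF inj_on_rank inj_on_rank] sub])
  then have "pre_digraph.digraph_isomorphism (with_proj (induced G Y)) f"
    using inj_on_rank[of Y] I.wf_digraph_axioms
    by (simp add: pre_digraph.digraph_isomorphism_def f_def induced_def)
  moreover have "with_proj (compress G Y) = app_iso f (with_proj (induced G Y))"
  proof -
    have "rank Y ` Y = {..<card Y}" using bij_betw_rank[OF fin] by (simp add: bij_betw_def)
    moreover have "map_prod (rank Y) (rank Y) ` parcs (induced G Y) = parcs (compress G Y)"
      by (force simp: induced_def compress_def)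
    ultimately show ?thesis
      by (simp add: app_iso_def f_def with_proj_def induced_def compress_def)
  qed
  ultimately show ?thesis unfolding digraph_iso_def by blast
qed

text \<open>Both directions come from closure under isomorphism; the answer of a recognition run on
  the relabelled graph is therefore the answer for the induced subgraph.\<close>

lemma compress_in_class_iff:
  assumes "graph_class \<C>" "pair_graph G" "Y \<subseteq> pverts G"
  shows "compress G Y \<in> \<C> \<longleftrightarrow> induced G Y \<in> \<C>"
proof
  note iso = compress_iso[OF assms(2,3)]
  have fin: "finite Y" using assms by (auto simp: pair_graph_iff intro: finite_subset)
  interpret I: pair_graph "induced G Y" using pair_graph_induced[OF assms(2,3)] .
  show "compress G Y \<in> \<C>" if "induced G Y \<in> \<C>"
    using assms(1) that iso pair_graph_compress[OF assms(2) fin] unfolding graph_class_def by blast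
  have "digraph_iso (with_proj (compress G Y)) (with_proj (induced G Y))"
    using digraph_iso_swap[OF I.wf_digraph_axioms iso] .
  then show "induced G Y \<in> \<C>" if "compress G Y \<in> \<C>"
    using assms(1) that I.pair_graph_axioms unfolding graph_class_def by blast
qed

text \<open>An independent set is maximal exactly if it is dominating. Both properties together form
  one condition per vertex, which can be read off the adjacency matrix.\<close>

lemma maximal_independent_set_iff:
  assumes "sym (parcs G)" "irrefl (parcs G)"
  shows "maximal_independent_set G I \<longleftrightarrow>
    I \<subseteq> pverts G \<and> (\<forall>v\<in>pverts G. v \<in> I \<longleftrightarrow> (\<forall>u\<in>I. (v, u) \<notin> parcs G))"
proof
  assume M: "maximal_independent_set G I"
  then have I: "independent_set G I" by (simp add: maximal_independent_set_def)
  have "v \<in> I \<longleftrightarrow> (\<forall>u\<in>I. (v, u) \<notin> parcs G)" if v: "v \<in> pverts G" for v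
  proof
    assume N: "\<forall>u\<in>I. (v, u) \<notin> parcs G"
    show "v \<in> I"
    proof (rule ccontr)
      assume "v \<notin> I"
      moreover have "independent_set G (insert v I)"
        using I N v assms by (auto simp: independent_set_def sym_def irrefl_def)
      ultimately show False using M unfolding maximal_independent_set_def by blast
    qed
  qed (use I in \<open>auto simp: independent_set_def\<close>)
  then show "I \<subseteq> pverts G \<and> (\<forall>v\<in>pverts G. v \<in> I \<longleftrightarrow> (\<forall>u\<in>I. (v, u) \<notin> parcs G))"
    using I by (simp add: independent_set_def)
next
  assume R: "I \<subseteq> pverts G \<and> (\<forall>v\<in>pverts G. v \<in> I \<longleftrightarrow> (\<forall>u\<in>I. (v, u) \<notin> parcs G))"
  then show "maximal_independent_set G I"
  proof -
    from R have "independent_set G I" unfolding independent_set_def by blast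
    moreover have False if J: "independent_set G J" "I \<subset> J" for J
    proof -
      from J obtain v where v: "v \<in> J" "v \<notin> I" by blast
      with J have "v \<in> pverts G" "\<forall>u\<in>I. (v, u) \<notin> parcs G"
        by (auto simp: independent_set_def)
      with R v show False by blast
    qed
    ultimately show ?thesis by (auto simp: maximal_independent_set_def)
  qed
qed

definition unrank :: "nat set \<Rightarrow> nat set \<Rightarrow> nat set" where
  "unrank Y K = {u\<in>Y. rank Y u \<in> K}"

text \<open>Injectivity matters as much as surjectivity: distinct sets listed by a simulated run
  must decode to distinct sets.\<close>

lemma unrank_MIS:
  assumes "pair_graph G" "Y \<subseteq> pverts G"
  shows "bij_betw (unrank Y) {K. maximal_independent_set (compress G Y) K}
    {I. maximal_independent_set (induced G Y) I}"
proof (rule bij_betw_byWitness[where f' = "image (rank Y)"])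
  have fin: "finite Y" using assms by (auto simp: pair_graph_iff intro: finite_subset)
  have img: "rank Y ` Y = {..<card Y}" using bij_betw_rank[OF fin] by (simp add: bij_betw_def)
  have C: "maximal_independent_set (compress G Y) K \<longleftrightarrow> K \<subseteq> rank Y ` Y \<and>
      (\<forall>v\<in>Y. rank Y v \<in> K \<longleftrightarrow> (\<forall>u\<in>K. (rank Y v, u) \<notin> parcs (compress G Y)))" for K
  proof -
    have "pverts (compress G Y) = rank Y ` Y" using img by (simp add: compress_def)
    then show ?thesis
      using maximal_independent_set_iff[of "compress G Y" K] pair_graph_compress[OF assms(1) fin]
      by (simp add: pair_graph_iff)
  qed
  have D: "maximal_independent_set (induced G Y) I \<longleftrightarrow> I \<subseteq> Y \<and>
      (\<forall>v\<in>Y. v \<in> I \<longleftrightarrow> (\<forall>u\<in>I. (v, u) \<notin> parcs G))" for I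
  proof -
    have "sym (parcs (induced G Y))" "irrefl (parcs (induced G Y))"
      using pair_graph_induced[OF assms] by (simp_all add: pair_graph_iff)
    then show ?thesis
      by (subst maximal_independent_set_iff) (simp_all add: induced_def, blast)
  qed
  show unrank: "\<forall>K\<in>{K. maximal_independent_set (compress G Y) K}. rank Y ` unrank Y K = K"
  proof clarify
    fix K assume "maximal_independent_set (compress G Y) K"
    then have "K \<subseteq> rank Y ` Y" by (simp add: C)
    then show "rank Y ` unrank Y K = K" unfolding unrank_def by blast
  qed
  show "\<forall>I\<in>{I. maximal_independent_set (induced G Y) I}. unrank Y (rank Y ` I) = I"
  proof clarify
    fix I assume "maximal_independent_set (induced G Y) I"
    then have "I \<subseteq> Y" by (simp add: D)
    then have "v \<in> Y \<and> rank Y v \<in> rank Y ` I \<longleftrightarrow> v \<in> I" for v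
      using inj_on_image_mem_iff[OF inj_on_rank, of v Y I] by blast
    then show "unrank Y (rank Y ` I) = I" by (simp add: unrank_def)
  qed
  show "unrank Y ` {K. maximal_independent_set (compress G Y) K}
      \<subseteq> {I. maximal_independent_set (induced G Y) I}"
  proof clarify
    fix K assume K: "maximal_independent_set (compress G Y) K"
    have arcs: "(\<forall>u\<in>K. (rank Y v, u) \<notin> parcs (compress G Y)) \<longleftrightarrow>
        (\<forall>u\<in>unrank Y K. (v, u) \<notin> parcs G)" if v: "v \<in> Y" for v
    proof -
      have "(\<forall>u\<in>rank Y ` unrank Y K. (rank Y v, u) \<notin> parcs (compress G Y)) \<longleftrightarrow>
          (\<forall>u\<in>unrank Y K. (v, u) \<notin> parcs G)"
        using compress_arc_iff[OF v] by (simp add: unrank_def)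
      then show ?thesis using unrank K by simp
    qed
    show "maximal_independent_set (induced G Y) (unrank Y K)"
      unfolding D
    proof (intro conjI ballI)
      show "unrank Y K \<subseteq> Y" by (auto simp: unrank_def)
      fix v assume v: "v \<in> Y"
      have "v \<in> unrank Y K \<longleftrightarrow> rank Y v \<in> K" using v by (simp add: unrank_def)
      also have "\<dots> \<longleftrightarrow> (\<forall>u\<in>K. (rank Y v, u) \<notin> parcs (compress G Y))"
        using K v unfolding C by blast
      also note arcs[OF v]
      finally show "v \<in> unrank Y K \<longleftrightarrow> (\<forall>u\<in>unrank Y K. (v, u) \<notin> parcs G)" .
    qed
  qed
  show "image (rank Y) ` {I. maximal_independent_set (induced G Y) I}
      \<subseteq> {K. maximal_independent_set (compress G Y) K}"
  proof clarify
    fix I assume I: "maximal_independent_set (induced G Y) I"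
    then have sub: "I \<subseteq> Y" by (simp add: D)
    show "maximal_independent_set (compress G Y) (rank Y ` I)"
      unfolding C
    proof (intro conjI ballI)
      show "rank Y ` I \<subseteq> rank Y ` Y" using sub by blast
      fix v assume v: "v \<in> Y"
      have "rank Y v \<in> rank Y ` I \<longleftrightarrow> v \<in> I" using inj_on_image_mem_iff[OF inj_on_rank v sub] .
      also have "\<dots> \<longleftrightarrow> (\<forall>u\<in>I. (v, u) \<notin> parcs G)" using I v unfolding D by blast
      also have "\<dots> \<longleftrightarrow> (\<forall>u\<in>rank Y ` I. (rank Y v, u) \<notin> parcs (compress G Y))"
        using compress_arc_iff[OF v] sub by blast
      finally show "rank Y v \<in> rank Y ` I \<longleftrightarrow>
        (\<forall>u\<in>rank Y ` I. (rank Y v, u) \<notin> parcs (compress G Y))" .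
    qed
  qed
qed

text \<open>
  Memory layout of the algorithm.  Registers: 0 the number of vertices, 2 the base address and 3 the
  first fresh address of the simulation, 4 and 5 scratch, 15 the write position in the output,
  16 the number of sets output so far, 17 the size of the sparse part \<open>X\<close>; loops use 9 to 12, 18, 19
  and everything from 30 on.  Arrays: 0 the input matrix, 1 the output, 2 the set generated by
  \<open>for_subsets\<close>, 3 the sparse part \<open>X\<close>, 4 the vertex set on which the next simulation runs.
\<close>

definition load_induced :: com where
  "load_induced =
     Seq (Const 6 0) (Seq (Add 2 3 6) (Seq (Add 7 3 6) (Seq (Const 8 0)
     (Seq (for_loop 9 10 0 (Seq (Load 13 4 9) (Seq (Add 6 6 13)
       (for_loop 11 12 0 (Seq (Load 14 4 11) (Seq (Sub 4 1 13) (Seq (Sub 14 14 4)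
         (Seq (IfNZ 14 (Seq (Load 5 0 8) (Seq (Store 6 7 5) (Add 7 7 1))) Skip)
           (Add 8 8 1)))))))))
     (Seq (Store 5 2 6) (Add 3 7 1))))))"

lemma written_load_induced [simp]:
  "written_regs load_induced = {2, 4, 5, 3, 6, 7, 8, 9, 10, 11, 12, 13, 14}" "written_arrs load_induced = {5, 6}"
  by (auto simp: load_induced_def)

definition run_on_induced :: "com \<Rightarrow> com" where
  "run_on_induced P = Seq load_induced (relocate P)"

lemma written_run_on_induced:
  "written_regs (run_on_induced P) \<subseteq> {2..14}" "written_arrs (run_on_induced P) \<subseteq> {5..}"
  using written_regs_relocate[of P] written_arrs_relocate[of P] by (auto simp: run_on_induced_def)

section \<open>Correctness of a simulated run on an induced subgraph\<close>

locale labelled_graph =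
  fixes n :: nat and G :: ngraph
  assumes graph: "pair_graph G" and verts: "pverts G = {..<n}"
begin

definition env :: "store \<Rightarrow> bool" where
  "env s \<longleftrightarrow> reg s 0 = n \<and> reg s 1 = 1 \<and>
     (\<forall>u<n. \<forall>v<n. arr s 0 (u * n + v) = (if (u, v) \<in> parcs G then 1 else 0)) \<and>
     (\<forall>a\<ge>5. \<forall>i\<ge>reg s 3. arr s a i = 0)"

lemma compress_matrix:
  assumes "u \<in> Y" "v \<in> Y" "finite Y"
  shows "arr (input_store (compress G Y)) 0 (rank Y u * card Y + rank Y v) =
    (if (u, v) \<in> parcs G then 1 else 0)"
proof -
  have r: "rank Y u < card Y" "rank Y v < card Y"
    using bij_betw_rank[OF assms(3)] assms by (auto simp: bij_betw_def)
  have "rank Y u * card Y + rank Y v < Suc (rank Y u) * card Y" using r by simp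
  also have "\<dots> \<le> card Y * card Y" using r by (intro mult_le_mono1) simp
  finally have "rank Y u * card Y + rank Y v < card Y * card Y" .
  moreover have "card (pverts (compress G Y)) = card Y" by (simp add: compress_def)
  ultimately show ?thesis using r compress_arc_iff[OF assms(1,2), of G]
    by (simp add: input_store_def Let_def)
qed

text \<open>The read index runs through the whole matrix of \<open>G\<close>, while the write index
  advances only at entries with row and column in \<open>Y\<close>. That conjunction is computed as
  the column bit minus the negated row bit. Array 5 at the base address is simulated register 0, so
  it receives the number of vertices; array 6 is simulated array 0.\<close>

lemma wp_load_induced:
  assumes s: "env s" and Y: "Y \<subseteq> {..<n}" "\<forall>u<n. arr s 4 u = ind Y u"
  shows "wp load_induced (\<lambda>s' t'. relocated (input_store (compress G Y)) s' \<and>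
    reg s' 6 = card Y \<and> t' \<le> t + 11 * (n + 1) ^ 2) s t"
proof -
  define b where "b = reg s 3"
  define m where "m = card Y"
  define h where "h = arr (input_store (compress G Y)) 0"
  \<comment> \<open>\<open>J p\<close> says that exactly the first \<open>p\<close> cells of the
    small matrix have been copied. Before column \<open>j\<close> of a row \<open>i\<close> in
    \<open>Y\<close> this number is \<open>rank Y i * m + rank Y j\<close>.\<close>
  define J where "J p s' \<longleftrightarrow> reg s' 7 = b + p \<and> (\<forall>k. arr s' 6 (b + k) = (if k < p then h k else 0))"
    for p and s' :: store
  have fin: "finite Y" using Y finite_subset by blast
  define s1 where "s1 = s\<lparr>reg := (reg s)(6 := 0, 2 := b, 7 := b, 8 := 0)\<rparr>"
  let ?P2 = "Seq (Load 14 4 11) (Seq (Sub 4 1 13) (Seq (Sub 14 14 4)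
         (Seq (IfNZ 14 (Seq (Load 5 0 8) (Seq (Store 6 7 5) (Add 7 7 1))) Skip) (Add 8 8 1))))"
  let ?P1 = "Seq (Load 13 4 9) (Seq (Add 6 6 13) (for_loop 11 12 0 ?P2))"
  let ?I = "\<lambda>i s'. reg s' 6 = rank Y i \<and> reg s' 8 = i * n \<and> J (rank Y i * m) s'"
  have s': "reg s 0 = n" "reg s 1 = 1" "b = reg s 3"
    "\<And>u v. u < n \<Longrightarrow> v < n \<Longrightarrow> arr s 0 (u * n + v) = (if (u, v) \<in> parcs G then 1 else 0)"
    "\<And>a i. 5 \<le> a \<Longrightarrow> b \<le> i \<Longrightarrow> arr s a i = 0"
    using s by (auto simp: env_def b_def)
  have inner: "wp (for_loop 11 12 0 ?P2) (\<lambda>s' t'. (reg s' 8 = i * n + n \<and>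
        J (rank Y i * m + (if i \<in> Y then rank Y n else 0)) s') \<and>
        frame ({11,12} \<union> written_regs ?P2) (written_arrs ?P2) s2 s' \<and> t' \<le> t2 + 3 + n * (8 + 3)) s2 t2"
    if i: "i < n" and r: "reg s2 8 = i * n" "reg s2 13 = ind Y i" "reg s2 0 = n" "reg s2 1 = 1"
      and a: "arr s2 0 = arr s 0" "arr s2 4 = arr s 4" and J: "J (rank Y i * m) s2" for i s2 t2
  proof (rule wp_for_loop[where N = n and I = "\<lambda>j s'. reg s' 8 = i * n + j \<and>
        J (rank Y i * m + (if i \<in> Y then rank Y j else 0)) s'"], goal_cases)
    case (10 j s3 t3)
    then have r3: "reg s3 13 = ind Y i" "reg s3 1 = 1" "arr s3 0 = arr s 0" "arr s3 4 = arr s 4"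
      and "reg s3 11 = j" "reg s3 8 = i * n + j" "j < n"
      and J3: "J (rank Y i * m + (if i \<in> Y then rank Y j else 0)) s3"
      using r a by (auto simp: frame_def)
    moreover have "arr s 0 (i * n + j) = h (rank Y i * m + rank Y j)" if "i \<in> Y" "j \<in> Y"
      using compress_matrix[OF that fin] s'(4)[OF i \<open>j < n\<close>] by (simp add: h_def m_def)
    ultimately show ?case using Y(2)
      by (auto simp: ind_def J_def rank_Suc less_Suc_eq)
  qed (use r J in \<open>auto simp: J_def\<close>)
  have outer: "wp (for_loop 9 10 0 ?P1) (\<lambda>s' t'. ?I n s' \<and>
      frame ({9,10} \<union> written_regs ?P1) (written_arrs ?P1) s1 s' \<and>
      t' \<le> t + 4 + 3 + n * ((2 + 3 + n * (8 + 3)) + 3)) s1 (t + 4)"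
  proof (rule wp_for_loop[where N = n and I = ?I], goal_cases)
    case (10 i s2 t2)
    let ?s3 = "s2\<lparr>reg := (reg s2)(13 := ind Y i, 6 := reg s2 6 + ind Y i)\<rparr>"
    from 10 have r2: "reg s2 0 = n" "reg s2 1 = 1" "arr s2 0 = arr s 0" "arr s2 4 = arr s 4"
      "reg s2 9 = i" "i < n" "reg s2 8 = i * n" "J (rank Y i * m) s2" "reg s2 6 = rank Y i"
      using s' by (auto simp: frame_def s1_def)
    have "wp (for_loop 11 12 0 ?P2) (\<lambda>s' t'. (reg s' 8 = i * n + n \<and>
        J (rank Y i * m + (if i \<in> Y then rank Y n else 0)) s') \<and>
        frame ({11,12} \<union> written_regs ?P2) (written_arrs ?P2) ?s3 s' \<and>
        t' \<le> t2 + 2 + 3 + n * (8 + 3)) ?s3 (t2 + 2)"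
      by (rule inner) (use r2 in \<open>auto simp: J_def\<close>)
    then show ?case using r2(1-6) Y(2)
      apply (simp add: numeral_2_eq_2)
      apply (erule wp_mono)
      using r2(9) rank_full[OF Y(1)]
      by (auto simp: frame_def rank_Suc J_def ind_def m_def algebra_simps)
  qed (use s' in \<open>auto simp: J_def s1_def\<close>)
  have time: "t + 4 + 3 + n * ((2 + 3 + n * (8 + 3)) + 3) + 2 \<le> t + 11 * (n + 1) ^ 2"
    by (simp add: power2_eq_square algebra_simps)
  have "wp (for_loop 9 10 0 ?P1) (wp (Seq (Store 5 2 6) (Add 3 7 1)) (\<lambda>s' t'.
      relocated (input_store (compress G Y)) s' \<and>
      reg s' 6 = card Y \<and> t' \<le> t + 11 * (n + 1) ^ 2)) s1 (t + 4)"
    using outer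
  proof (rule wp_mono, goal_cases)
    case (1 s2 t2)
    have m: "rank Y n = m" using rank_full[OF Y(1)] by (simp add: m_def)
    have reg: "reg s2 2 = b" "reg s2 1 = 1" "reg s2 6 = m" "reg s2 7 = b + m * m"
      and arr: "\<And>a. a \<noteq> 6 \<Longrightarrow> arr s2 a = arr s a"
        "\<And>k. arr s2 6 (b + k) = (if k < m * m then h k else 0)"
      using 1 s'(2) m by (auto simp: frame_def J_def s1_def)
    have h0: "h k = 0" if "\<not> k < m * m" for k
      using that by (auto simp: h_def m_def input_store_def compress_def Let_def)
    have in0: "reg (input_store (compress G Y)) x = (if x = 0 then m else 0)"
      "arr (input_store (compress G Y)) a = (if a = 0 then h else (\<lambda>_. 0))" for x a
      by (auto simp: h_def m_def input_store_def compress_def Let_def)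
    have z: "arr s2 a i = 0" if "5 \<le> a" "a \<noteq> 6" "b \<le> i" for a i
      using arr(1) s'(5) that by simp
    have "arr s2 6 i = 0" if "b + m * m \<le> i" for i
    proof -
      have "\<not> i - b < m * m" "b + (i - b) = i" using that by linarith+
      then show ?thesis using arr(2)[of "i - b"] by simp
    qed
    then have z': "arr s2 a i = 0" if "5 \<le> a" "b + m * m \<le> i" for a i
      using that z by (cases "a = 6") auto
    have "5 + 2 * x \<noteq> (6::nat)" for x by presburger
    then have regs: "arr s2 (5 + 2 * x) b = 0" for x using z by simp
    have "arr s2 (6 + 2 * a) (b + i) = (if a = 0 \<and> i < m * m then h i else 0)" for a i
      using z[of "6 + 2 * a" "b + i"] arr(2)[of i] by (cases "a = 0") simp_all
    then show ?case using 1 time reg h0 regs z'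
      by (auto simp: relocated_def in0 m_def[symmetric])
  qed
  then show ?thesis using s'(2)
    by (simp add: load_induced_def s1_def b_def eval_nat_numeral)
qed

lemma wp_run_on_induced:
  assumes s: "env s" and Y: "Y \<subseteq> {..<n}" "\<forall>u<n. arr s 4 u = ind Y u"
    and P: "exec P (input_store (compress G Y)) k s'"
  shows "wp (run_on_induced P) (\<lambda>h t'. relocated s' h \<and> env h \<and> reg h 6 = card Y \<and>
    t' \<le> t + 11 * (n + 1) ^ 2 + 8 * k) s t"
proof -
  have "wp load_induced (wp (relocate P) (\<lambda>h t'. (relocated s' h \<and> reg h 6 = card Y) \<and>
    t' \<le> t + 11 * (n + 1) ^ 2 + 8 * k)) s t"
    using wp_load_induced[OF s Y]
  proof (rule wp_mono, goal_cases)
    case (1 s1 t1)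
    then have "relocated (input_store (compress G Y)) s1" by simp
    from wp_relocate[OF P this, of t1] show ?case
    proof (rule wp_conseq, goal_cases)
      case (1 s2 t2)
      have "reg s2 6 = reg s1 6"
        by (rule frame_reg[OF 1(2)]) (use written_regs_relocate[of P] in auto)
      then show ?case using 1(1) \<open>_ \<and> _ \<and> t1 \<le> _\<close> by simp
    qed
  qed
  then have "wp (run_on_induced P) (\<lambda>h t'. (relocated s' h \<and> reg h 6 = card Y) \<and>
    t' \<le> t + 11 * (n + 1) ^ 2 + 8 * k) s t"
    by (simp add: run_on_induced_def)
  then show ?thesis
  proof (rule wp_conseq, goal_cases)
    case (1 h t')
    have "reg h 0 = reg s 0" "arr h 0 = arr s 0"
      by (rule frame_reg[OF 1(2)] frame_arr[OF 1(2)], use written_run_on_induced[of P] in fastforce)+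
    then have "env h" using s 1(1) unfolding env_def relocated_def by simp
    then show ?case using 1(1) by simp
  qed
qed

end

section \<open>Local search for the sparse part\<close>

text \<open>Symmetric differences cover the removals and additions of an exchange by a single small
  set. A symmetric difference of bits is the sum of the two truncated differences. Register 6 is the
  size of the tested set, left there by the loading phase; an improvement replaces \<open>X\<close>
  at once, in the middle of a pass.\<close>

definition improve :: "com \<Rightarrow> com" where
  "improve P =
     Seq (for_loop 9 10 0 (Seq (Load 13 3 9) (Seq (Load 14 2 9) (Seq (Sub 4 13 14)
       (Seq (Sub 14 14 13) (Seq (Add 4 4 14) (Store 4 9 4)))))))
     (Seq (run_on_induced P) (Seq (Load 13 5 2)
       (IfNZ 13 (Seq (Sub 13 6 17)
         (IfNZ 13 (Seq (for_loop 9 10 0 (Seq (Load 13 4 9) (Store 3 9 13)))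
           (Seq (Const 4 0) (Add 17 6 4))) Skip)) Skip)))"

lemma written_improve:
  "written_regs (improve P) \<subseteq> {2..14} \<union> {17}" "written_arrs (improve P) \<subseteq> {3, 4} \<union> {5..}"
  using written_run_on_induced[of P] by (auto simp: improve_def)

text \<open>The target size is unknown to the program, so the number of passes is fixed; surplus
  passes never shrink \<open>X\<close>.\<close>

definition local_search :: "nat \<Rightarrow> com \<Rightarrow> com" where
  "local_search q P = Seq (Add 32 0 1) (for_loop 30 31 32
     (Seq (Const 4 0) (Seq (Add (40 + 2 * q) 0 4) (for_subsets q (improve P)))))"

lemma written_local_search:
  "written_regs (local_search q P) \<subseteq> {2..14} \<union> {17} \<union> {30..}"
  "written_arrs (local_search q P) \<subseteq> {2..}"
  using written_improve[of P] written_regs_for_subsets[of q "improve P"]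
    written_arrs_for_subsets[of q "improve P"]
  by (auto simp: local_search_def; fastforce)+

context labelled_graph
begin

definition holds_set :: "nat set \<Rightarrow> store \<Rightarrow> bool" where
  "holds_set X s \<longleftrightarrow> X \<subseteq> {..<n} \<and> (\<forall>u<n. arr s 3 u = ind X u) \<and> reg s 17 = card X"

lemma wp_improve:
  assumes s: "env s" "holds_set X s" "arr s 2 = ind F" and F: "F \<subseteq> {..<n}"
    and P: "exec P (input_store (compress G (sym_diff X F))) k s'" "k \<le> T"
  shows "wp (improve P) (\<lambda>s1 t1. env s1 \<and>
    holds_set (if reg s' 0 \<noteq> 0 \<and> card X < card (sym_diff X F) then sym_diff X F else X) s1 \<and>
    t1 \<le> t + (40 * (n + 1) ^ 2 + 8 * T)) s t"
proof -
  let ?Y = "sym_diff X F"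
  let ?P1 = "Seq (Load 13 3 9) (Seq (Load 14 2 9) (Seq (Sub 4 13 14)
       (Seq (Sub 14 14 13) (Seq (Add 4 4 14) (Store 4 9 4)))))"
  let ?P2 = "Seq (Load 13 4 9) (Store 3 9 13)"
  have s': "reg s 0 = n" "reg s 1 = 1" using s by (auto simp: env_def)
  have Y: "?Y \<subseteq> {..<n}" using s F by (auto simp: holds_set_def)
  have 1: "wp (for_loop 9 10 0 ?P1) (\<lambda>s' t'. (\<forall>u<n. arr s' 4 u = ind ?Y u) \<and>
      frame ({9,10} \<union> written_regs ?P1) (written_arrs ?P1) s s' \<and> t' \<le> t + 3 + n * (6 + 3)) s t"
  proof (rule wp_for_loop[where N = n and I = "\<lambda>i s'. \<forall>u<i. arr s' 4 u = ind ?Y u"], goal_cases)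
    case (10 i s2 t2)
    then have "arr s2 3 = arr s 3" "arr s2 2 = ind F" "i < n" using s by (auto simp: frame_def)
    then show ?case using 10 s by (auto simp: holds_set_def ind_def less_Suc_eq)
  qed (use s' in auto)
  have 2: "wp (for_loop 9 10 0 ?P2) (\<lambda>s' t'. (\<forall>u<n. arr s' 3 u = ind ?Y u) \<and>
      frame ({9,10} \<union> written_regs ?P2) (written_arrs ?P2) s2 s' \<and> t' \<le> t2 + 3 + n * (2 + 3)) s2 t2"
    if s2: "reg s2 0 = n" "reg s2 1 = 1" "\<forall>u<n. arr s2 4 u = ind ?Y u" for s2 t2
  proof (rule wp_for_loop[where N = n and I = "\<lambda>i s'. \<forall>u<i. arr s' 3 u = ind ?Y u"], goal_cases)
    case (10 i s3 t3)
    then have "arr s3 4 = arr s2 4" "i < n" by (auto simp: frame_def)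
    then show ?case using 10 s2 by (auto simp: less_Suc_eq)
  qed (use s2 in auto)
  have time: "(3 + n * (6 + 3)) + 11 * (n + 1) ^ 2 + (3 + n * (2 + 3)) + 10 \<le> 40 * (n + 1) ^ 2"
    by (simp add: power2_eq_square algebra_simps)
  show ?thesis
    unfolding improve_def wp_Seq
  proof (rule wp_mono[OF 1], goal_cases)
    case (1 s1 t1)
    have reg1: "reg s1 17 = reg s 17" "arr s1 3 = arr s 3"
      using 1 by (auto simp: frame_def)
    have "env s1" using 1 s(1) by (auto simp: env_def frame_def)
    from wp_run_on_induced[OF this Y _ P(1)] 1
    have "wp (run_on_induced P) (\<lambda>h t'. relocated s' h \<and> env h \<and> reg h 6 = card ?Y \<and>
      t' \<le> t1 + 11 * (n + 1)\<^sup>2 + 8 * k) s1 t1" by simp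
    then show ?case
    proof (rule wp_conseq, goal_cases)
      case (1 s2 t2)
      have "17 \<notin> written_regs (run_on_induced P)" "3 \<notin> written_arrs (run_on_induced P)" "4 \<notin> written_arrs (run_on_induced P)"
        using written_run_on_induced[of P] by auto
      then have fr: "reg s2 17 = reg s1 17" "arr s2 3 = arr s1 3" "arr s2 4 = arr s1 4"
        using 1(2) by (simp_all add: frame_def)
      have "arr s2 (5 + 2 * 0) (reg s2 2) = reg s' 0" using 1(1) unfolding relocated_def by blast
      then have res: "arr s2 5 (reg s2 2) = reg s' 0" by simp
      have env2: "reg s2 0 = n" "reg s2 1 = 1" using 1 by (auto simp: env_def)
      have X2: "reg s2 17 = card X" using s fr reg1 by (simp add: holds_set_def)
      have tt: "t2 + 10 + (3 + n * (2 + 3)) \<le> t + (40 * (n + 1) ^ 2 + 8 * T)"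
        using 1(1) \<open>_ \<and> _ \<and> t1 \<le> _\<close> time P(2) by linarith
      show ?case
      proof (cases "reg s' 0 \<noteq> 0 \<and> card X < card ?Y")
        case True
        let ?s3 = "s2\<lparr>reg := (reg s2)(13 := card ?Y - card X)\<rparr>"
        have "wp (for_loop 9 10 0 ?P2) (\<lambda>s' t'. (\<forall>u<n. arr s' 3 u = ind ?Y u) \<and>
          frame ({9,10} \<union> written_regs ?P2) (written_arrs ?P2) ?s3 s' \<and>
          t' \<le> t2 + 1 + 1 + 1 + 1 + 3 + n * (2 + 3)) ?s3 (t2 + 1 + 1 + 1 + 1)"
          by (rule 2) (use env2 fr \<open>_ \<and> _ \<and> t1 \<le> _\<close> in auto)
        then have "wp (for_loop 9 10 0 ?P2) (wp (Seq (Const 4 0) (Add 17 6 4)) (\<lambda>s1 t1. env s1 \<and>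
           holds_set ?Y s1 \<and> t1 \<le> t + (40 * (n + 1) ^ 2 + 8 * T))) ?s3 (t2 + 1 + 1 + 1 + 1)"
        proof (rule wp_mono, goal_cases)
          case (1 s4 t4)
          then have "reg s4 6 = card ?Y" "env s4"
            using \<open>relocated _ _ \<and> _\<close> by (auto simp: frame_def env_def)
          then show ?case using 1 tt Y by (auto simp: env_def holds_set_def)
        qed
        then show ?thesis using True res X2 1(1) by simp
      next
        case False
        have "env (s2\<lparr>reg := (reg s2)(13 := y)\<rparr>)" "holds_set X (s2\<lparr>reg := (reg s2)(13 := y)\<rparr>)" for y
          using 1 s X2 fr reg1 by (auto simp: env_def holds_set_def)
        then show ?thesis using False res X2 1(1) tt by auto
      qed
    qed
  qed
qed

lemma wp_local_search:
  fixes ok :: "nat set \<Rightarrow> bool"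
  assumes s: "env s" "holds_set {} s" "arr s 2 = ind {}"
    and ok: "ok {}"
      "\<And>X. X \<subseteq> {..<n} \<Longrightarrow> ok X \<Longrightarrow> card X < K \<Longrightarrow>
        \<exists>F\<subseteq>{..<n}. card F \<le> q \<and> ok (sym_diff X F) \<and> card X < card (sym_diff X F)"
      "K \<le> n + 1"
    and P: "\<And>Y. Y \<subseteq> {..<n} \<Longrightarrow>
      \<exists>k s'. exec P (input_store (compress G Y)) k s' \<and> k \<le> T \<and> (reg s' 0 \<noteq> 0 \<longleftrightarrow> ok Y)"
  shows "wp (local_search q P) (\<lambda>s' t'. env s' \<and> arr s' 2 = ind {} \<and>
    (\<exists>X. holds_set X s' \<and> ok X \<and> K \<le> card X) \<and>
    t' \<le> t + 4 + (n + 1) * (subsets_time n (40 * (n + 1) ^ 2 + 8 * T) q + 5)) s t"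
proof -
  let ?B = "40 * (n + 1) ^ 2 + 8 * T"
  let ?P = "Seq (Const 4 0) (Seq (Add (40 + 2 * q) 0 4) (for_subsets q (improve P)))"
  \<comment> \<open>Every pass gains a vertex until \<open>K\<close> is reached, and later passes
    lose none.\<close>
  let ?I = "\<lambda>i s. env s \<and> arr s 2 = ind {} \<and> (\<exists>X. holds_set X s \<and> ok X \<and> min i K \<le> card X)"
  let ?s = "s\<lparr>reg := (reg s)(32 := n + 1)\<rparr>"
  have s': "reg s 0 = n" "reg s 1 = 1" using s by (auto simp: env_def)
  have wr: "written_regs ?P \<subseteq> {2..17} \<union> {40..}"
    using written_improve[of P] written_regs_for_subsets[of q "improve P"] by fastforce
  have pass: "wp (for_subsets q (improve P)) (\<lambda>s' t'. env s' \<and> arr s' 2 = ind {} \<and>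
      (\<exists>X. holds_set X s' \<and> ok X \<and> (card X0 < K \<longrightarrow> card X0 < card X) \<and> card X0 \<le> card X) \<and>
      t' \<le> t + subsets_time n ?B q) s t"
    if s: "env s" "holds_set X0 s" "ok X0" "arr s 2 = ind {}" "reg s (40 + 2 * q) = n" for s t X0
  proof -
    let ?better = "\<lambda>X F. ok (sym_diff X F) \<and> card X < card (sym_diff X F)"
    \<comment> \<open>Once \<open>X\<close> has been replaced, the remaining sets are tried against
      the new \<open>X\<close> and say nothing about \<open>X0\<close>. So failures are recorded
      only as long as \<open>X = X0\<close>; afterwards the strict growth required of the pass is
      already achieved.\<close>
    let ?Inv = "\<lambda>E s. env s \<and> (\<exists>X. holds_set X s \<and> ok X \<and>
      (X = X0 \<and> (\<forall>F\<in>E. \<not> ?better X0 F) \<or> card X0 < card X))"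
    have "wp (for_subsets q (improve P)) (\<lambda>s' t'. ?Inv ({} \<union> small_subsets n q {}) s' \<and>
      arr s' 2 = ind {} \<and> t' \<le> t + subsets_time n ?B q) s t"
    proof (rule wp_for_subsets[where n = n and Q = q])
      fix E C s t
      assume I: "?Inv E s" and C: "arr s 2 = ind C" "C \<subseteq> {..<n}"
      then obtain X where X: "holds_set X s" "ok X"
          "X = X0 \<and> (\<forall>F\<in>E. \<not> ?better X0 F) \<or> card X0 < card X" by blast
      have "sym_diff X C \<subseteq> {..<n}" using X C by (auto simp: holds_set_def)
      with P obtain k s' where k: "exec P (input_store (compress G (sym_diff X C))) k s'" "k \<le> T"
        "reg s' 0 \<noteq> 0 \<longleftrightarrow> ok (sym_diff X C)" by blast
      have "env s" using I by simp
      from wp_improve[OF this X(1) C k(1,2)]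
      show "wp (improve P) (\<lambda>s' t'. ?Inv (insert C E) s' \<and> t' \<le> t + ?B) s t"
      proof (rule wp_mono, goal_cases)
        case (1 s1 t1)
        let ?X = "if reg s' 0 \<noteq> 0 \<and> card X < card (sym_diff X C) then sym_diff X C else X"
        have "ok ?X" using X k by auto
        moreover have "?X = X0 \<and> (\<forall>F\<in>insert C E. \<not> ?better X0 F) \<or> card X0 < card ?X"
          using X(3) k(3) by auto
        ultimately show ?case using 1 by blast
      qed
    next
      show "1 \<notin> written_regs (improve P)" "written_regs (improve P) \<inter> {40..} = {}"
        "2 \<notin> written_arrs (improve P)" using written_improve[of P] by fastforce+
    next
      fix E s s'
      assume I: "?Inv E s" and fr: "frame ({4} \<union> {40..}) {2} s s'"
      have "reg s' 0 = reg s 0" "reg s' 1 = reg s 1" "reg s' 3 = reg s 3" "reg s' 17 = reg s 17"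
        "arr s' 0 = arr s 0" "arr s' 3 = arr s 3" "\<And>a. 5 \<le> a \<Longrightarrow> arr s' a = arr s a"
        using fr by (auto simp: frame_def)
      then show "?Inv E s'" using I by (auto simp: env_def holds_set_def)
    next
      show "?Inv {} s" using s by auto
    qed (use s in \<open>auto simp: env_def\<close>)
    then show ?thesis
    proof (rule wp_mono, goal_cases)
      case (1 s' t')
      then obtain X where X: "holds_set X s'" "ok X"
        "X = X0 \<and> (\<forall>F\<in>small_subsets n q {}. \<not> ?better X0 F) \<or> card X0 < card X" by auto
      have "card X0 < card X" if "card X0 < K"
      proof (rule ccontr)
        assume "\<not> card X0 < card X"
        with X(3) have no: "\<forall>F\<in>small_subsets n q {}. \<not> ?better X0 F" by auto
        have "X0 \<subseteq> {..<n}" using s by (simp add: holds_set_def)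
        from ok(2)[OF this s(3) that] no show False by (auto simp: small_subsets_def)
      qed
      then show ?case using 1 X by (auto intro: less_imp_le)
    qed
  qed
  have "wp (for_loop 30 31 32 ?P) (\<lambda>s' t'. ?I (n + 1) s' \<and>
      frame ({30,31} \<union> written_regs ?P) (written_arrs ?P) ?s s' \<and>
      t' \<le> (t + 1) + 3 + (n + 1) * ((subsets_time n ?B q + 2) + 3)) ?s (t + 1)"
  proof (rule wp_for_loop[where N = "n + 1" and I = ?I], goal_cases)
    case (10 i s2 t2)
    then obtain X0 where X0: "holds_set X0 s2" "ok X0" "min i K \<le> card X0" by auto
    let ?s3 = "s2\<lparr>reg := (reg s2)(4 := 0, 40 + 2 * q := n)\<rparr>"
    have "wp (for_subsets q (improve P)) (\<lambda>s' t'. env s' \<and> arr s' 2 = ind {} \<and>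
      (\<exists>X. holds_set X s' \<and> ok X \<and> (card X0 < K \<longrightarrow> card X0 < card X) \<and> card X0 \<le> card X) \<and>
      t' \<le> t2 + 1 + 1 + subsets_time n ?B q) ?s3 (t2 + 1 + 1)"
      by (rule pass) (use 10 X0 in \<open>auto simp: env_def holds_set_def\<close>)
    then have "wp (for_subsets q (improve P)) (\<lambda>s'' t'.
       ?I (Suc i) (s''\<lparr>reg := (reg s'')(30 := Suc i, 31 := n + 1 - Suc i)\<rparr>) \<and>
       t' \<le> t2 + (subsets_time n ?B q + 2)) ?s3 (t2 + 1 + 1)"
    proof (rule wp_mono, goal_cases)
      case (1 s4 t4)
      then obtain X where "holds_set X s4" "ok X" "card X0 < K \<longrightarrow> card X0 < card X"
        "card X0 \<le> card X" by blast
      moreover from this X0 have "min (Suc i) K \<le> card X" by auto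
      ultimately show ?case using 1 by (auto simp: env_def holds_set_def)
    qed
    moreover have "reg s2 0 = n" using 10 by (simp add: env_def)
    ultimately show ?case by simp
  next
    case 9
    show ?case using s ok(1) by (auto simp: env_def holds_set_def)
  qed (use s' wr in auto)
  then show ?thesis
    unfolding local_search_def wp_Seq wp_Add
    using s' ok(3) by (auto simp: add.commute add.left_commute elim!: wp_mono)
qed

end

section \<open>Listing the maximal independent sets\<close>

text \<open>The sum of two bits minus 1 is their conjunction. Register 14 starts as membership in
  \<open>X\<close> and is cleared by the first neighbour in the set held in array 2.\<close>

definition free_part :: com where
  "free_part = Seq (Const 8 0) (for_loop 9 10 0 (Seq (Load 14 3 9)
     (Seq (for_loop 11 12 0 (Seq (Load 13 0 8) (Seq (Load 4 2 11) (Seq (Add 13 13 4)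
       (Seq (Sub 13 13 1) (Seq (Sub 14 14 13) (Add 8 8 1)))))))
     (Store 4 9 14))))"

text \<open>Array 8 is simulated array 1, that is, the output of the simulated run. Register 21
  advances by one cell for each vertex of the simulated graph and thus never needs a
  product.\<close>

definition decode :: com where
  "decode = Seq (Const 4 0) (Seq (Add 7 15 4) (for_loop 9 10 0 (Seq (Load 13 2 9)
     (Seq (Load 14 4 9) (Seq (IfNZ 14 (Seq (Load 14 8 21) (Seq (Add 13 13 14) (Add 21 21 1))) Skip)
     (Seq (Store 1 7 13) (Add 7 7 1)))))))"

text \<open>Besides maximal independence this tests that the set in array 2 avoids \<open>X\<close>.
  Then it equals \<open>I - X\<close> for every accepted \<open>I\<close>, so no \<open>I\<close>
  can be accepted for two different sets.\<close>

definition check_MIS :: com where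
  "check_MIS = Seq (Const 6 1) (Seq (Const 8 0) (Seq (Const 4 0) (Seq (Add 22 15 4)
     (for_loop 9 10 0 (Seq (Const 14 0) (Seq (Const 4 0) (Seq (Add 7 15 4)
       (Seq (for_loop 11 12 0 (Seq (Load 13 0 8) (Seq (Load 5 1 7)
         (Seq (IfNZ 13 (Add 14 14 5) Skip) (Seq (Add 8 8 1) (Add 7 7 1))))))
       (Seq (Load 13 1 22) (Seq (Add 22 22 1)
       (Seq (IfNZ 13 (IfNZ 14 (Const 6 0) Skip) (IfNZ 14 Skip (Const 6 0)))
       (Seq (Load 13 2 9) (Seq (Load 5 3 9) (Seq (Add 13 13 5) (Seq (Sub 13 13 1) (Sub 6 6 13)))))))))))))))) "

text \<open>The candidate is written directly behind the output. Accepting it only means advancing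
  the write position; a rejected one is overwritten by the next.\<close>

definition process_candidate :: com where
  "process_candidate = Seq decode (Seq check_MIS (IfNZ 6 (Seq (Add 15 15 0) (Add 16 16 1)) Skip))"

definition list_extensions :: "com \<Rightarrow> com" where
  "list_extensions P = Seq free_part (Seq (run_on_induced P) (Seq (Load 20 5 2) (Seq (Const 4 0) (Seq (Add 21 2 4)
     (for_loop 18 19 20 process_candidate)))))"

lemma written_candidate [simp]:
  "written_regs decode = {4, 7, 9, 10, 13, 14, 21}" "written_arrs decode = {1}"
  "written_regs check_MIS = {4, 5, 6, 7, 8, 9, 10, 11, 12, 13, 14, 22}" "written_arrs check_MIS = {}"
  "written_regs free_part = {4, 8, 9, 10, 11, 12, 13, 14}" "written_arrs free_part = {4}"
  by (auto simp: decode_def check_MIS_def free_part_def)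

lemma written_list_extensions:
  "written_regs (list_extensions P) \<subseteq> {2..22}" "written_arrs (list_extensions P) \<subseteq> {1} \<union> {4..}"
  using written_run_on_induced[of P] by (auto simp: list_extensions_def process_candidate_def)

context labelled_graph
begin

lemma matrix: "env s \<Longrightarrow> u < n \<Longrightarrow> v < n \<Longrightarrow> arr s 0 (u * n + v) = (if (u, v) \<in> parcs G then 1 else 0)"
  by (auto simp: env_def)

definition free_vertices :: "nat set \<Rightarrow> nat set \<Rightarrow> nat set" where
  "free_vertices X J = {u\<in>X. \<forall>v\<in>J. (u, v) \<notin> parcs G}"

lemma wp_free_part:
  assumes s: "env s" "\<forall>u<n. arr s 3 u = ind X u" "arr s 2 = ind J" "J \<subseteq> {..<n}"
  shows "wp free_part (\<lambda>s' t'. (\<forall>u<n. arr s' 4 u = ind (free_vertices X J) u) \<and> t' \<le> t + 15 * (n + 1) ^ 2) s t"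
proof -
  let ?P2 = "Seq (Load 13 0 8) (Seq (Load 4 2 11) (Seq (Add 13 13 4)
       (Seq (Sub 13 13 1) (Seq (Sub 14 14 13) (Add 8 8 1)))))"
  let ?P1 = "Seq (Load 14 3 9) (Seq (for_loop 11 12 0 ?P2) (Store 4 9 14))"
  let ?s = "s\<lparr>reg := (reg s)(8 := 0)\<rparr>"
  have s': "reg s 0 = n" "reg s 1 = 1" using s by (auto simp: env_def)
  have inner: "wp (for_loop 11 12 0 ?P2) (\<lambda>s' t'. (reg s' 8 = i * n + n \<and>
        reg s' 14 = (if i \<in> X \<and> (\<forall>v<n. v \<in> J \<longrightarrow> (i, v) \<notin> parcs G) then 1 else 0)) \<and>
        frame ({11,12} \<union> written_regs ?P2) (written_arrs ?P2) s2 s' \<and> t' \<le> t2 + 3 + n * (6 + 3)) s2 t2"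
    if i: "i < n" and r: "reg s2 8 = i * n" "reg s2 14 = ind X i" "reg s2 0 = n" "reg s2 1 = 1"
      and a: "arr s2 0 = arr s 0" "arr s2 2 = ind J" for i s2 t2
  proof (rule wp_for_loop[where N = n and I = "\<lambda>j s'. reg s' 8 = i * n + j \<and>
        reg s' 14 = (if i \<in> X \<and> (\<forall>v<j. v \<in> J \<longrightarrow> (i, v) \<notin> parcs G) then 1 else 0)"], goal_cases)
    case (10 j s3 t3)
    then have "arr s3 0 = arr s 0" "arr s3 2 = ind J" "reg s3 11 = j" "reg s3 8 = i * n + j" "j < n"
      "reg s3 1 = 1" using r a by (auto simp: frame_def)
    then show ?case using 10 matrix[OF s(1) i, of j]
      by (auto simp: ind_def less_Suc_eq)
  qed (use r in \<open>auto simp: ind_def\<close>)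
  have "wp (for_loop 9 10 0 ?P1) (\<lambda>s' t'. (reg s' 8 = n * n \<and> (\<forall>u<n. arr s' 4 u = ind (free_vertices X J) u)) \<and>
      frame ({9,10} \<union> written_regs ?P1) (written_arrs ?P1) ?s s' \<and>
      t' \<le> t + 1 + 3 + n * ((2 + (3 + n * (6 + 3))) + 3)) ?s (t + 1)"
  proof (rule wp_for_loop[where N = n and I = "\<lambda>i s'. reg s' 8 = i * n \<and>
      (\<forall>u<i. arr s' 4 u = ind (free_vertices X J) u)"], goal_cases)
    case (10 i s2 t2)
    let ?s3 = "s2\<lparr>reg := (reg s2)(14 := ind X i)\<rparr>"
    from 10 have r2: "reg s2 0 = n" "reg s2 1 = 1" "arr s2 0 = arr s 0" "arr s2 2 = ind J"
      "arr s2 3 = arr s 3" "reg s2 9 = i" "i < n" "reg s2 8 = i * n"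
      "\<forall>u<i. arr s2 4 u = ind (free_vertices X J) u"
      using s s' by (auto simp: frame_def)
    have "wp (for_loop 11 12 0 ?P2) (\<lambda>s' t'. (reg s' 8 = i * n + n \<and>
        reg s' 14 = (if i \<in> X \<and> (\<forall>v<n. v \<in> J \<longrightarrow> (i, v) \<notin> parcs G) then 1 else 0)) \<and>
        frame ({11,12} \<union> written_regs ?P2) (written_arrs ?P2) ?s3 s' \<and> t' \<le> t2 + 1 + 3 + n * (6 + 3)) ?s3 (t2 + 1)"
      by (rule inner) (use r2 in auto)
    moreover have "ind (free_vertices X J) i = (if i \<in> X \<and> (\<forall>v<n. v \<in> J \<longrightarrow> (i, v) \<notin> parcs G) then 1 else 0)"
      using s(4) by (auto simp: ind_def free_vertices_def)
    ultimately have "wp (for_loop 11 12 0 ?P2) (wp (Store 4 9 14) (\<lambda>s'' t'.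
       (reg (s''\<lparr>reg := (reg s'')(9 := Suc i, 10 := n - Suc i)\<rparr>) 8 = Suc i * n \<and>
       (\<forall>u<Suc i. arr (s''\<lparr>reg := (reg s'')(9 := Suc i, 10 := n - Suc i)\<rparr>) 4 u = ind (free_vertices X J) u)) \<and>
       t' \<le> t2 + (2 + (3 + n * (6 + 3))))) ?s3 (t2 + 1)"
      using r2 by (elim wp_mono) (auto simp: frame_def less_Suc_eq)
    then show ?case using r2 s(2) by simp
  qed (use s' in auto)
  moreover have "1 + 3 + n * ((2 + (3 + n * (6 + 3))) + 3) \<le> 15 * (n + 1) ^ 2"
    by (simp add: power2_eq_square algebra_simps)
  ultimately show ?thesis unfolding free_part_def wp_Seq wp_Const
    by (elim wp_mono) auto
qed

lemma wp_decode:
  assumes s: "reg s 0 = n" "reg s 1 = 1" "arr s 2 = ind J" "\<forall>u<n. arr s 4 u = ind Y u"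
    and Y: "Y \<subseteq> {..<n}"
  shows "wp decode (\<lambda>s' t'. (\<forall>u<n. arr s' 1 (reg s 15 + u) \<noteq> 0 \<longleftrightarrow>
      u \<in> J \<union> {u\<in>Y. arr s 8 (reg s 21 + rank Y u) \<noteq> 0}) \<and>
    (\<forall>i<reg s 15. arr s' 1 i = arr s 1 i) \<and>
    reg s' 21 = reg s 21 + card Y \<and> t' \<le> t + 15 * (n + 1)) s t"
proof -
  let ?P = "Seq (Load 13 2 9)
     (Seq (Load 14 4 9) (Seq (IfNZ 14 (Seq (Load 14 8 21) (Seq (Add 13 13 14) (Add 21 21 1))) Skip)
     (Seq (Store 1 7 13) (Add 7 7 1))))"
  let ?s = "s\<lparr>reg := (reg s)(4 := 0, 7 := reg s 15)\<rparr>"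
  let ?I = "\<lambda>i s'. reg s' 7 = reg s 15 + i \<and> reg s' 21 = reg s 21 + rank Y i \<and>
    (\<forall>u<i. arr s' 1 (reg s 15 + u) \<noteq> 0 \<longleftrightarrow> u \<in> J \<union> {u\<in>Y. arr s 8 (reg s 21 + rank Y u) \<noteq> 0}) \<and>
    (\<forall>i<reg s 15. arr s' 1 i = arr s 1 i)"
  have "wp (for_loop 9 10 0 ?P) (\<lambda>s' t'. ?I n s' \<and>
      frame ({9,10} \<union> written_regs ?P) (written_arrs ?P) ?s s' \<and>
      t' \<le> t + 1 + 1 + 3 + n * (8 + 3)) ?s (t + 1 + 1)"
  proof (rule wp_for_loop[where N = n and I = ?I], goal_cases)
    case (10 i s2 t2)
    then have "arr s2 2 = ind J" "arr s2 4 i = ind Y i" "arr s2 8 = arr s 8" "i < n"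
      "reg s2 1 = 1" "reg s2 9 = i"
      using s by (auto simp: frame_def)
    then show ?case using 10 s(2)
      by (auto simp: rank_Suc ind_def less_Suc_eq)
  qed (use s in auto)
  then show ?thesis using rank_full[OF Y] unfolding decode_def wp_Seq wp_Const wp_Add
    by (auto elim!: wp_mono)
qed

lemma wp_check_MIS:
  assumes s: "env s" "arr s 2 = ind J" "\<forall>u<n. arr s 3 u = ind X u" "X \<subseteq> {..<n}"
    and I: "I \<subseteq> {..<n}" "\<forall>u<n. arr s 1 (reg s 15 + u) \<noteq> 0 \<longleftrightarrow> u \<in> I"
  shows "wp check_MIS (\<lambda>s' t'. (reg s' 6 \<noteq> 0 \<longleftrightarrow> maximal_independent_set G I \<and> J \<inter> X = {}) \<and>
    t' \<le> t + 20 * (n + 1) ^ 2) s t"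
proof -
  let ?P2 = "Seq (Load 13 0 8) (Seq (Load 5 1 7)
         (Seq (IfNZ 13 (Add 14 14 5) Skip) (Seq (Add 8 8 1) (Add 7 7 1))))"
  let ?R = "Seq (Load 13 1 22) (Seq (Add 22 22 1)
       (Seq (IfNZ 13 (IfNZ 14 (Const 6 0) Skip) (IfNZ 14 Skip (Const 6 0)))
       (Seq (Load 13 2 9) (Seq (Load 5 3 9) (Seq (Add 13 13 5) (Seq (Sub 13 13 1) (Sub 6 6 13)))))))"
  let ?P1 = "Seq (Const 14 0) (Seq (Const 4 0) (Seq (Add 7 15 4) (Seq (for_loop 11 12 0 ?P2) ?R)))"
  let ?s = "s\<lparr>reg := (reg s)(6 := 1, 8 := 0, 4 := 0, 22 := reg s 15)\<rparr>"
  define nb where "nb v \<longleftrightarrow> (\<exists>u<n. u \<in> I \<and> (v, u) \<in> parcs G)" for v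
  define good where "good v \<longleftrightarrow> (v \<in> I \<longleftrightarrow> \<not> nb v) \<and> \<not> (v \<in> J \<and> v \<in> X)" for v
  have s': "reg s 0 = n" "reg s 1 = 1" using s by (auto simp: env_def)
  have inner: "wp (for_loop 11 12 0 ?P2) (\<lambda>s' t'. (reg s' 8 = i * n + n \<and> reg s' 7 = reg s 15 + n \<and>
        (reg s' 14 \<noteq> 0 \<longleftrightarrow> (\<exists>u<n. u \<in> I \<and> (i, u) \<in> parcs G))) \<and>
        frame ({11,12} \<union> written_regs ?P2) (written_arrs ?P2) s2 s' \<and> t' \<le> t2 + 3 + n * (6 + 3)) s2 t2"
    if i: "i < n" and r: "reg s2 8 = i * n" "reg s2 14 = 0" "reg s2 0 = n" "reg s2 1 = 1"
       "reg s2 7 = reg s 15"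
      and a: "arr s2 0 = arr s 0" "arr s2 1 = arr s 1" for i s2 t2
  proof (rule wp_for_loop[where N = n and I = "\<lambda>j s'. reg s' 8 = i * n + j \<and> reg s' 7 = reg s 15 + j \<and>
        (reg s' 14 \<noteq> 0 \<longleftrightarrow> (\<exists>u<j. u \<in> I \<and> (i, u) \<in> parcs G))"], goal_cases)
    case (10 j s3 t3)
    then have "arr s3 0 = arr s 0" "arr s3 1 = arr s 1" "j < n" "reg s3 1 = 1"
      using r a by (auto simp: frame_def)
    then show ?case using 10 matrix[OF s(1) i, of j] I(2)
      by (auto simp: less_Suc_eq)
  qed (use r in auto)
  let ?I = "\<lambda>i s'. reg s' 8 = i * n \<and> reg s' 22 = reg s 15 + i \<and>
      reg s' 6 = (if \<forall>v<i. good v then 1 else 0)"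
  have "wp (for_loop 9 10 0 ?P1) (\<lambda>s' t'. ?I n s' \<and>
      frame ({9,10} \<union> written_regs ?P1) (written_arrs ?P1) ?s s' \<and>
      t' \<le> t + 1 + 1 + 1 + 1 + 3 + n * ((13 + (3 + n * (6 + 3))) + 3)) ?s (t + 1 + 1 + 1 + 1)"
  proof (rule wp_for_loop[where N = n and I = ?I], goal_cases)
    case (10 i s2 t2)
    let ?s3 = "s2\<lparr>reg := (reg s2)(14 := 0, 4 := 0, 7 := reg s 15)\<rparr>"
    from 10 have r2: "reg s2 0 = n" "reg s2 1 = 1" "reg s2 15 = reg s 15" "arr s2 = arr s"
      "reg s2 9 = i" "i < n" "?I i s2"
      using s s' by (auto simp: frame_def)
    have "wp (for_loop 11 12 0 ?P2) (\<lambda>s' t'. (reg s' 8 = i * n + n \<and> reg s' 7 = reg s 15 + n \<and>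
        (reg s' 14 \<noteq> 0 \<longleftrightarrow> (\<exists>u<n. u \<in> I \<and> (i, u) \<in> parcs G))) \<and>
        frame ({11,12} \<union> written_regs ?P2) (written_arrs ?P2) ?s3 s' \<and>
        t' \<le> t2 + 1 + 1 + 1 + 3 + n * (6 + 3)) ?s3 (t2 + 1 + 1 + 1)"
      by (rule inner) (use r2 in auto)
    then have "wp (for_loop 11 12 0 ?P2) (wp ?R (\<lambda>s'' t'.
       ?I (Suc i) (s''\<lparr>reg := (reg s'')(9 := Suc i, 10 := n - Suc i)\<rparr>) \<and>
       t' \<le> t2 + (13 + (3 + n * (6 + 3))))) ?s3 (t2 + 1 + 1 + 1)"
    proof (rule wp_mono, goal_cases)
      case (1 s4 t4)
      have "arr s4 = arr s" using 1 r2 by (auto simp: frame_def)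
      moreover have "reg s4 14 \<noteq> 0 \<longleftrightarrow> nb i" "reg s4 1 = 1" "reg s4 9 = i" "reg s4 15 = reg s 15"
        "reg s4 22 = reg s 15 + i" "reg s4 6 = (if \<forall>v<i. good v then 1 else 0)"
        "reg s4 8 = i * n + n"
        using 1 r2 by (auto simp: frame_def nb_def)
      moreover have "t4 \<le> t2 + 6 + n * 9" using 1 by simp
      moreover have "(\<forall>v<Suc i. good v) \<longleftrightarrow> (\<forall>v<i. good v) \<and> good i"
        by (auto simp: less_Suc_eq)
      ultimately show ?case using I(2) s(2,3) r2(6)
        by (simp add: ind_def) (auto simp: good_def)
    qed
    then show ?case using r2 by simp
  qed (use s' in auto)
  moreover have "1 + 1 + 1 + 1 + 3 + n * ((13 + (3 + n * (6 + 3))) + 3) \<le> 20 * (n + 1) ^ 2"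
    by (simp add: power2_eq_square algebra_simps)
  moreover have "(\<forall>v<n. good v) \<longleftrightarrow> maximal_independent_set G I \<and> J \<inter> X = {}"
  proof -
    have "maximal_independent_set G I \<longleftrightarrow> (\<forall>v<n. v \<in> I \<longleftrightarrow> (\<forall>u\<in>I. (v, u) \<notin> parcs G))"
      using maximal_independent_set_iff[of G I] graph verts I(1) by (auto simp: pair_graph_iff)
    moreover have "(\<forall>u\<in>I. (v, u) \<notin> parcs G) \<longleftrightarrow> \<not> nb v" for v
      using I(1) by (auto simp: nb_def)
    ultimately show ?thesis using s(4) by (auto simp: good_def)
  qed
  ultimately show ?thesis unfolding check_MIS_def wp_Seq wp_Const wp_Add
    by simp (elim wp_mono, auto split: if_splits)
qed

section \<open>The output list\<close>

definition listing :: "store \<Rightarrow> nat set list \<Rightarrow> bool" where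
  "listing s L \<longleftrightarrow> reg s 16 = length L \<and> reg s 15 = length L * n \<and>
     (\<forall>i<length L. L ! i \<subseteq> {..<n} \<and> (\<forall>u<n. arr s 1 (i * n + u) \<noteq> 0 \<longleftrightarrow> u \<in> L ! i))"

text \<open>The listing occupies only cells below register 15, so the remains of a rejected
  candidate do no harm.\<close>

lemma listing_same:
  assumes "listing s L" "reg s' 16 = reg s 16" "reg s' 15 = reg s 15"
    and "\<forall>i<reg s 15. arr s' 1 i = arr s 1 i"
  shows "listing s' L"
proof -
  have "i * n + u < length L * n" if "i < length L" "u < n" for i u
  proof -
    have "i * n + u < Suc i * n" using that by simp
    also have "\<dots> \<le> length L * n" using that by (intro mult_le_mono1) simp
    finally show ?thesis .
  qed
  then show ?thesis using assms by (auto simp: listing_def)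
qed

lemma listing_reg_upd [simp]:
  "x \<noteq> 15 \<Longrightarrow> x \<noteq> 16 \<Longrightarrow> y \<noteq> 15 \<Longrightarrow> y \<noteq> 16 \<Longrightarrow>
     listing (s\<lparr>reg := (reg s)(x := a, y := b)\<rparr>) L = listing s L"
  by (simp add: listing_def)

lemma listing_snoc:
  assumes L: "listing s L" and s': "reg s' 16 = reg s 16 + 1" "reg s' 15 = reg s 15 + n"
    and old: "\<forall>i<reg s 15. arr s' 1 i = arr s 1 i"
    and new: "I \<subseteq> {..<n}" "\<forall>u<n. arr s' 1 (reg s 15 + u) \<noteq> 0 \<longleftrightarrow> u \<in> I"
  shows "listing s' (L @ [I])"
proof -
  have "listing (s'\<lparr>reg := (reg s')(16 := reg s 16, 15 := reg s 15)\<rparr>) L"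
    by (rule listing_same[OF L]) (use old in auto)
  then show ?thesis using L s' new by (auto simp: listing_def nth_append less_Suc_eq)
qed

lemma listed_sets_listing:
  assumes "listing s L"
  shows "listed_sets n (s\<lparr>reg := (reg s)(0 := reg s 16)\<rparr>) = L"
proof (rule nth_equalityI)
  show "length (listed_sets n (s\<lparr>reg := (reg s)(0 := reg s 16)\<rparr>)) = length L"
    using assms by (simp add: listed_sets_def listing_def)
  show "listed_sets n (s\<lparr>reg := (reg s)(0 := reg s 16)\<rparr>) ! i = L ! i"
    if "i < length (listed_sets n (s\<lparr>reg := (reg s)(0 := reg s 16)\<rparr>))" for i
    using assms that by (auto simp: listed_sets_def listing_def)
qed

lemma wp_process_candidate:
  fixes I Y :: "nat set"
  assumes s: "env s" "holds_set X s" "arr s 2 = ind J" "\<forall>u<n. arr s 4 u = ind Y u" "listing s L"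
    and J: "J \<subseteq> {..<n}" and Y: "Y \<subseteq> {..<n}"
    and I: "I = J \<union> {u\<in>Y. arr s 8 (reg s 21 + rank Y u) \<noteq> 0}"
  shows "wp process_candidate (\<lambda>s' t'.
    listing s' (L @ (if maximal_independent_set G I \<and> J \<inter> X = {} then [I] else [])) \<and>
    reg s' 21 = reg s 21 + card Y \<and> t' \<le> t + 50 * (n + 1) ^ 2) s t"
proof -
  have s': "reg s 0 = n" "reg s 1 = 1" using s by (auto simp: env_def)
  have In: "I \<subseteq> {..<n}" using I J Y by auto
  have time: "15 * (n + 1) + 20 * (n + 1) ^ 2 + 3 \<le> 50 * (n + 1) ^ 2"
    by (simp add: power2_eq_square algebra_simps)
  show ?thesis unfolding process_candidate_def wp_Seq
  proof (rule wp_conseq[OF wp_decode[OF s' s(3,4) Y]], goal_cases)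
    case (1 s1 t1)
    have d: "\<forall>u<n. arr s1 1 (reg s 15 + u) \<noteq> 0 \<longleftrightarrow> u \<in> I" "\<forall>i<reg s 15. arr s1 1 i = arr s 1 i"
      "reg s1 21 = reg s 21 + card Y" "t1 \<le> t + 15 * (n + 1)"
      using 1(1) unfolding I by blast+
    have r: "reg s1 15 = reg s 15" "reg s1 16 = reg s 16" "reg s1 0 = n"
      "env s1" "arr s1 2 = ind J" "\<forall>u<n. arr s1 3 u = ind X u" "X \<subseteq> {..<n}"
      using 1(2) s s' by (auto simp: frame_def env_def holds_set_def)
    have d': "\<forall>u<n. arr s1 1 (reg s1 15 + u) \<noteq> 0 \<longleftrightarrow> u \<in> I" using d(1) r(1) by simp
    show ?case
    proof (rule wp_conseq[OF wp_check_MIS[OF r(4-7) In d']], goal_cases)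
      case (1 s2 t2)
      have r2: "reg s2 15 = reg s 15" "reg s2 16 = reg s 16" "reg s2 0 = n" "reg s2 1 = 1"
        "reg s2 21 = reg s 21 + card Y" "arr s2 1 = arr s1 1"
        using 1(2) r d by (auto simp: frame_def env_def)
      have t2: "t2 + 3 \<le> t + 50 * (n + 1) ^ 2" using 1(1) d(4) time by linarith
      show ?case
      proof (cases "maximal_independent_set G I \<and> J \<inter> X = {}")
        case True
        have "listing (s2\<lparr>reg := (reg s2)(15 := reg s2 15 + n, 16 := reg s2 16 + 1)\<rparr>) (L @ [I])"
          by (rule listing_snoc[OF s(5)]) (use r2 d In in auto)
        then show ?thesis using True 1(1) r2 t2 by simp
      next
        case False
        have "listing s2 L" by (rule listing_same[OF s(5)]) (use r2 d in auto)
        then show ?thesis using False 1(1) r2 t2 by auto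
      qed
    qed
  qed
qed

lemma wp_list_extensions:
  fixes J X :: "nat set"
  defines "Y \<equiv> free_vertices X J"
  assumes s: "env s" "holds_set X s" "arr s 2 = ind J" "listing s L" and J: "J \<subseteq> {..<n}"
    and P: "exec P (input_store (compress G Y)) k s'" "k \<le> T" "distinct (listed_sets (card Y) s')"
  shows "wp (list_extensions P) (\<lambda>s1 t1. env s1 \<and> holds_set X s1 \<and>
    listing s1 (L @ filter (\<lambda>I. maximal_independent_set G I \<and> J \<inter> X = {})
      (map (\<lambda>K. J \<union> unrank Y K) (listed_sets (card Y) s'))) \<and>
    t1 \<le> t + 100 * (n + 1) ^ 2 * (T + 1)) s t"
proof -
  let ?good = "\<lambda>I. maximal_independent_set G I \<and> J \<inter> X = {}"
  let ?K = "\<lambda>i. {v. v < card Y \<and> arr s' 1 (i * card Y + v) \<noteq> 0}"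
  have Y: "Y \<subseteq> {..<n}" using s by (auto simp: Y_def free_vertices_def holds_set_def)
  have fin: "finite Y" using Y finite_subset by blast
  \<comment> \<open>The number of candidates is bounded by the running time of the enumeration,
    because its outputs are distinct.\<close>
  have cnt: "reg s' 0 \<le> T + 1"
    using distinct_listed_sets_bound[OF P(1,3)] P(2) by linarith
  have time: "15 * (n + 1) ^ 2 + 11 * (n + 1) ^ 2 + 8 * T + 6 +
      (T + 1) * (50 * (n + 1) ^ 2 + 3) \<le> 100 * (n + 1) ^ 2 * (T + 1)"
    by (simp add: power2_eq_square algebra_simps)
  have X: "\<forall>u<n. arr s 3 u = ind X u" using s by (simp add: holds_set_def)
  show ?thesis unfolding list_extensions_def wp_Seq wp_Load wp_Const wp_Add
  proof (rule wp_conseq[OF wp_free_part[OF s(1) X s(3) J]], goal_cases)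
    case (1 s1 t1)
    have Y1: "\<forall>u<n. arr s1 4 u = ind Y u" using 1 by (simp add: Y_def)
    have r1: "env s1" "holds_set X s1" "arr s1 2 = ind J" "listing s1 L"
      using 1(2) s by (auto simp: frame_def env_def holds_set_def listing_def)
    show ?case
    proof (rule wp_conseq[OF wp_run_on_induced[OF r1(1) Y Y1 P(1)]], goal_cases)
      case (1 s2 t2)
      have "{1, 15, 16, 17} \<inter> written_regs (run_on_induced P) = {}" "{1, 2, 3, 4} \<inter> written_arrs (run_on_induced P) = {}"
        using written_run_on_induced[of P] by auto
      then have "reg s2 17 = reg s1 17" "reg s2 16 = reg s1 16" "reg s2 15 = reg s1 15"
        "arr s2 1 = arr s1 1" "arr s2 2 = arr s1 2" "arr s2 3 = arr s1 3" "arr s2 4 = arr s1 4"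
        using 1(2) by (simp_all add: frame_def)
      then have r2: "env s2" "holds_set X s2" "arr s2 2 = ind J" "listing s2 L"
        "\<forall>u<n. arr s2 4 u = ind Y u"
        using 1(1) r1 Y1 by (auto simp: holds_set_def listing_def)
      have "arr s2 (5 + 2 * 0) (reg s2 2) = reg s' 0"
        using 1(1) unfolding relocated_def by blast
      then have res: "arr s2 5 (reg s2 2) = reg s' 0" by simp
      have "arr s2 (6 + 2 * 1) (reg s2 2 + i) = arr s' 1 i" for i
        using 1(1) unfolding relocated_def by blast
      then have sets: "arr s2 8 (reg s2 2 + i) = arr s' 1 i" for i by simp
      let ?s3 = "s2\<lparr>reg := (reg s2)(20 := reg s' 0, 4 := 0, 21 := reg s2 2)\<rparr>"
      let ?I = "\<lambda>i h. listing h (L @ filter ?good (map (\<lambda>i. J \<union> unrank Y (?K i)) [0..<i])) \<and>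
        reg h 21 = reg s2 2 + i * card Y"
      have "wp (for_loop 18 19 20 process_candidate) (\<lambda>h t'. ?I (reg s' 0) h \<and>
        frame ({18, 19} \<union> written_regs process_candidate) (written_arrs process_candidate) ?s3 h \<and>
        t' \<le> t2 + 1 + 1 + 1 + 3 + reg s' 0 * (50 * (n + 1) ^ 2 + 3)) ?s3 (t2 + 1 + 1 + 1)"
      proof (rule wp_for_loop[where N = "reg s' 0" and I = ?I], goal_cases)
        case (10 i h t')
        have h: "env h" "holds_set X h" "arr h 2 = ind J" "\<forall>u<n. arr h 4 u = ind Y u"
          "arr h 8 = arr s2 8"
          using 10(4) r2 by (auto simp: frame_def env_def holds_set_def process_candidate_def)
        have "u \<in> Y \<and> arr h 8 (reg h 21 + rank Y u) \<noteq> 0 \<longleftrightarrow> u \<in> unrank Y (?K i)" for u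
          using 10(2) sets[of "i * card Y + rank Y u"] h(5) bij_betw_rank[OF fin]
          by (auto simp: unrank_def bij_betw_def add.assoc)
        then have "J \<union> unrank Y (?K i) = J \<union> {u\<in>Y. arr h 8 (reg h 21 + rank Y u) \<noteq> 0}"
          by blast
        note process_candidate = wp_process_candidate[OF h(1-4) conjunct1[OF 10(2)] J Y this]
        show ?case
          by (rule wp_mono[OF process_candidate]) (use 10(2) in \<open>auto split: if_splits\<close>)
      qed (use r2 in \<open>auto simp: env_def listing_def process_candidate_def\<close>)
      then have "wp (for_loop 18 19 20 process_candidate) (\<lambda>h t'. env h \<and> holds_set X h \<and>
        listing h (L @ filter ?good (map (\<lambda>K. J \<union> unrank Y K) (listed_sets (card Y) s'))) \<and>
        t' \<le> t + 100 * (n + 1) ^ 2 * (T + 1)) ?s3 (t2 + 1 + 1 + 1)"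
      proof (rule wp_mono, goal_cases)
        case (1 h t')
        have "env h" "holds_set X h"
          using 1 r2 by (auto simp: frame_def env_def holds_set_def process_candidate_def)
        moreover have "map (\<lambda>K. J \<union> unrank Y K) (listed_sets (card Y) s') =
            map (\<lambda>i. J \<union> unrank Y (?K i)) [0..<reg s' 0]"
          by (simp add: listed_sets_def)
        moreover have "t' \<le> t + 100 * (n + 1) ^ 2 * (T + 1)"
        proof -
          have "reg s' 0 * (50 * (n + 1) ^ 2 + 3) \<le> (T + 1) * (50 * (n + 1) ^ 2 + 3)"
            using cnt by (rule mult_le_mono1)
          then show ?thesis
            using 1 time P(2) \<open>relocated _ _ \<and> _\<close> \<open>_ \<and> t1 \<le> _\<close> by linarith
        qed
        ultimately show ?case using 1 by simp
      qed
      then show ?case using res by simp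
    qed
  qed
qed

end

section \<open>Sparse-dense graphs\<close>

lemma hereditary_induced:
  assumes "hereditary \<C>" "induced G A \<in> \<C>" "B \<subseteq> A"
  shows "induced G B \<in> \<C>"
proof -
  have "B \<subseteq> pverts (induced G A)" using assms(3) by (simp add: induced_def)
  then have "induced (induced G A) B \<in> \<C>" using assms unfolding hereditary_def by blast
  then show ?thesis by (simp only: induced_induced[OF assms(3)])
qed

text \<open>\<open>X\<close> and \<open>A\<close> share \<open>X \<inter> A\<close>, so
  \<open>card X < card A\<close> forces \<open>A - X\<close> to be larger than \<open>X - A\<close>,
  which is \<open>X \<inter> B\<close>. Hence there is room for a set \<open>W\<close> with one
  vertex more than is removed. The result lies inside \<open>A\<close> and is sparse by
  heredity.\<close>

lemma sparse_dense_exchange: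
  assumes cls: "sparse_dense_classes c \<S> \<D>" and part: "sparse_dense_partition \<S> \<D> G A B"
    and G: "pair_graph G" and X: "X \<subseteq> pverts G" "induced G X \<in> \<S>" "card X < card A"
  shows "\<exists>F\<subseteq>pverts G. card F \<le> 2 * c + 1 \<and> induced G (sym_diff X F) \<in> \<S> \<and>
    card X < card (sym_diff X F)"
proof -
  have AB: "A \<union> B = pverts G" "A \<inter> B = {}" "induced G A \<in> \<S>" "induced G B \<in> \<D>"
    using part by (auto simp: sparse_dense_partition_def)
  have fin: "finite (pverts G)" using G by (simp add: pair_graph_iff)
  then have finX: "finite X" and finA: "finite A" using X AB by (auto intro: finite_subset)
  have XB: "card (X \<inter> B) \<le> c"
    using cls G X AB unfolding sparse_dense_classes_def by blast
  have XA: "X - B = X \<inter> A" "X \<inter> B = X - A" using X AB by auto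
  have cX: "card X = card (X \<inter> A) + card (X \<inter> B)"
    using card_Int_Diff[OF finX, of A] XA by simp
  have cA: "card A = card (X \<inter> A) + card (A - X)"
    using card_Int_Diff[OF finA, of X] by (simp add: Int_commute)
  have "card (X \<inter> B) + 1 \<le> card (A - X)" using cX cA X(3) by linarith
  then obtain W where W: "W \<subseteq> A - X" "card W = card (X \<inter> B) + 1"
    using obtain_subset_with_card_n by metis
  have finW: "finite W" using W finA finite_subset by blast
  let ?F = "(X \<inter> B) \<union> W"
  have sd: "sym_diff X ?F = (X \<inter> A) \<union> W" using W XA AB by auto
  have "card ?F \<le> 2 * c + 1" using card_Un_le[of "X \<inter> B" W] W XB by linarith
  moreover have "?F \<subseteq> pverts G" using W AB X by auto
  moreover have "card ((X \<inter> A) \<union> W) = card (X \<inter> A) + card W"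
    by (rule card_Un_disjoint) (use W finX finW in auto)
  moreover have "induced G ((X \<inter> A) \<union> W) \<in> \<S>"
  proof -
    have sub: "(X \<inter> A) \<union> W \<subseteq> A" using W by auto
    have "hereditary \<S>" using cls by (simp add: sparse_dense_classes_def)
    then show ?thesis using AB(3) sub by (rule hereditary_induced)
  qed
  ultimately show ?thesis using W(2) cX unfolding sd[symmetric] by (intro exI[of _ ?F]) simp
qed

text \<open>A vertex of \<open>I\<close> outside \<open>X\<close> lies in \<open>B\<close> or in
  \<open>A - X\<close>. The vertices in \<open>B\<close> form an independent set of a dense graph,
  which gives the summand \<open>t\<close>; those in \<open>A - X\<close> give the summand
  \<open>c\<close>.\<close>

lemma sparse_dense_outside:
  assumes cls: "sparse_dense_classes c \<S> \<D>" and part: "sparse_dense_partition \<S> \<D> G A B"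
    and cf: "\<D> \<subseteq> co_clique_free_graphs t"
    and G: "pair_graph G" and X: "X \<subseteq> pverts G" "induced G X \<in> \<S>" "card A \<le> card X"
    and I: "maximal_independent_set G I"
  shows "card (I - X) \<le> t + c"
proof -
  have AB: "A \<union> B = pverts G" "A \<inter> B = {}" "induced G A \<in> \<S>" "induced G B \<in> \<D>"
    using part by (auto simp: sparse_dense_partition_def)
  have fin: "finite (pverts G)" using G by (simp add: pair_graph_iff)
  then have finX: "finite X" and finA: "finite A" and finB: "finite B"
    using X AB by (auto intro: finite_subset)
  have XB: "card (X \<inter> B) \<le> c"
    using cls G X AB unfolding sparse_dense_classes_def by blast
  have "X \<inter> B = X - A" using X AB by auto
  then have "card (A - X) \<le> c"
    using card_Int_Diff[OF finX, of A] card_Int_Diff[OF finA, of X] X(3) XB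
    by (simp add: Int_commute)
  moreover have "card (I \<inter> B) \<le> t"
  proof (rule ccontr)
    assume "\<not> card (I \<inter> B) \<le> t"
    then have "t \<le> card (I \<inter> B)" by simp
    \<comment> \<open>The class forbids independent sets of size exactly \<open>t\<close>, so one of
      this size is cut out of the larger one.\<close>
    then obtain W where W: "W \<subseteq> I \<inter> B" "card W = t"
      by (rule obtain_subset_with_card_n)
    moreover have "independent_set G I" using I by (simp add: maximal_independent_set_def)
    ultimately have "independent_set (induced G B) W"
      unfolding independent_set_def induced_def by simp blast
    moreover have "\<not> (\<exists>I. independent_set (induced G B) I \<and> card I = t)"
      using subsetD[OF cf AB(4)] by (simp add: co_clique_free_graphs_def)
    ultimately show False using W(2) by metis
  qed
  moreover have "I \<subseteq> pverts G" using I by (simp add: maximal_independent_set_def independent_set_def)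
  then have "I - X \<subseteq> (I \<inter> B) \<union> (A - X)" using AB by auto
  then have "card (I - X) \<le> card ((I \<inter> B) \<union> (A - X))"
    by (rule card_mono[rotated]) (use finA finB in auto)
  moreover have "card ((I \<inter> B) \<union> (A - X)) \<le> card (I \<inter> B) + card (A - X)" by (rule card_Un_le)
  ultimately show ?thesis by linarith
qed

section \<open>The running time as a power of \<open>n\<close>\<close>

definition total_time :: "nat \<Rightarrow> nat \<Rightarrow> nat \<Rightarrow> nat \<Rightarrow> nat \<Rightarrow> nat" where
  "total_time c t n T1 T2 =
     9 + (n + 1) * (subsets_time n (40 * (n + 1) ^ 2 + 8 * T1) (2 * c + 1) + 5) +
     subsets_time n (100 * (n + 1) ^ 2 * (T2 + 1)) (t + c)"

text \<open>There is no leading constant to hide anything in. For \<open>n\<close> at least 2 the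
  total factor, at most 256, is below \<open>n ^ 8\<close>, and \<open>n + 2\<close> is at most
  \<open>n ^ 2\<close>. The remaining exponent \<open>6 * c + 2 * t + 16\<close> is at most
  \<open>(6 * c + 18) * t\<close> because \<open>t\<close> is positive.\<close>

lemma total_time_bound:
  assumes n: "2 \<le> n" and t: "1 \<le> t" and T1: "1 \<le> T1"
  shows "total_time c t n T1 T2 \<le> (T1 + T2) * n ^ ((6 * c + 18) * t)"
proof -
  define U N where "U = T1 + T2" and "N = n + 2"
  \<comment> \<open>\<open>E\<close> dominates both exponents of \<open>N\<close>:
    \<open>2 * c + 4\<close> for the search (1 for the passes, 2 for a test,
    \<open>2 * c + 1\<close> for the sets) and \<open>t + c + 2\<close> for the listing.\<close>
  define E where "E = 3 * c + t + 4"
  have U: "1 \<le> U" "T1 \<le> U" "T2 + 1 \<le> U" and N: "n + 1 \<le> N" "4 \<le> N"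
    using T1 n by (auto simp: U_def N_def)
  have sq: "(n + 1) ^ 2 \<le> N ^ 2" using N by (intro power_mono) auto
  have NU: "1 \<le> N ^ 2 * U" using N U by simp
  have sqU: "(n + 1) ^ 2 \<le> N ^ 2 * U" using mult_le_mono[OF sq U(1)] by simp
  have "U \<le> N ^ 2 * U" using N by simp
  then have b1: "40 * (n + 1) ^ 2 + 8 * T1 + 6 \<le> 54 * (N ^ 2 * U)"
    using sqU NU U by linarith
  have b2: "100 * (n + 1) ^ 2 * (T2 + 1) + 6 \<le> 106 * (N ^ 2 * U)"
  proof -
    have "100 * a + 6 \<le> 106 * b" if "a \<le> b" "1 \<le> b" for a b :: nat
      using that by linarith
    from this[OF mult_le_mono[OF sq U(3)] NU] show ?thesis by (simp only: mult.assoc)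
  qed
  have s1: "subsets_time n (40 * (n + 1) ^ 2 + 8 * T1) (2 * c + 1) + 6 \<le> 54 * (N ^ 2 * U) * N ^ (2 * c + 1)"
    by (rule order.trans[OF subsets_time_bound]) (use b1 in \<open>simp add: N_def\<close>)
  have s2: "subsets_time n (100 * (n + 1) ^ 2 * (T2 + 1)) (t + c) + 6 \<le> 106 * (N ^ 2 * U) * N ^ (t + c)"
    by (rule order.trans[OF subsets_time_bound]) (use b2 in \<open>simp add: N_def\<close>)
  have "(n + 1) * (subsets_time n (40 * (n + 1) ^ 2 + 8 * T1) (2 * c + 1) + 5) \<le>
      N * (54 * (N ^ 2 * U) * N ^ (2 * c + 1))"
    by (rule mult_le_mono) (use N s1 in auto)
  also have "\<dots> = 54 * (U * N ^ (2 * c + 4))"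
  proof -
    have "N ^ (2 * c + 4) = N ^ (1 + 2 + (2 * c + 1))" by (simp add: eval_nat_numeral)
    also have "\<dots> = N * N ^ 2 * N ^ (2 * c + 1)" by (simp only: power_add power_one_right)
    finally show ?thesis by (simp only: mult_ac)
  qed
  also have "\<dots> \<le> 54 * (U * N ^ E)"
    using N by (intro mult_le_mono2 power_increasing) (auto simp: E_def)
  finally have a1: "(n + 1) * (subsets_time n (40 * (n + 1) ^ 2 + 8 * T1) (2 * c + 1) + 5) \<le>
    54 * (U * N ^ E)" .
  have "106 * (N ^ 2 * U) * N ^ (t + c) = 106 * (U * N ^ (t + c + 2))"
    by (simp only: power_add mult_ac)
  also have "\<dots> \<le> 106 * (U * N ^ E)"
    using N by (intro mult_le_mono2 power_increasing) (auto simp: E_def)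
  finally have a2: "subsets_time n (100 * (n + 1) ^ 2 * (T2 + 1)) (t + c) \<le> 106 * (U * N ^ E)"
    using s2 by linarith
  have one: "1 \<le> U * N ^ E" using U N by simp
  have "total_time c t n T1 T2 \<le> 256 * (U * N ^ E)"
    unfolding total_time_def using a1 a2 one by linarith
  also have "\<dots> \<le> n ^ 8 * (U * (n ^ 2) ^ E)"
  proof (intro mult_le_mono power_mono)
    have "(2::nat) ^ 8 \<le> n ^ 8" using n by (intro power_mono) auto
    then show "256 \<le> n ^ 8" by simp
    have "n + 2 \<le> n * 2" using n by simp
    also have "\<dots> \<le> n * n" using n by (intro mult_le_mono2)
    finally show "N \<le> n ^ 2" by (simp add: N_def power2_eq_square)
  qed auto
  also have "\<dots> = U * n ^ (8 + 2 * E)" by (simp add: power_add power_mult)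
  also have "\<dots> \<le> U * n ^ ((6 * c + 18) * t)"
  proof (intro mult_le_mono2 power_increasing)
    obtain r where "t = Suc r" using t by (cases t) auto
    then show "8 + 2 * E \<le> (6 * c + 18) * t" by (simp add: E_def algebra_simps)
  qed (use n in auto)
  finally show ?thesis by (simp add: U_def)
qed

definition enumerate_MIS :: "nat \<Rightarrow> nat \<Rightarrow> com \<Rightarrow> com \<Rightarrow> com" where
  "enumerate_MIS p q P1 P2 = Seq (Const 1 1) (Seq (local_search p P1)
     (Seq (Const 4 0) (Seq (Add (40 + 2 * q) 0 4) (Seq (for_subsets q (list_extensions P2))
     (Seq (Const 4 0) (Add 0 16 4))))))"

context labelled_graph
begin

section \<open>Completeness and distinctness of the list\<close>

lemma MIS_iff: "maximal_independent_set G I \<longleftrightarrow>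
  I \<subseteq> {..<n} \<and> (\<forall>v<n. v \<in> I \<longleftrightarrow> (\<forall>u\<in>I. (v, u) \<notin> parcs G))"
proof -
  have "sym (parcs G)" "irrefl (parcs G)" using graph by (simp_all add: pair_graph_iff)
  then show ?thesis by (simp add: maximal_independent_set_iff verts Ball_def)
qed

lemma MIS_induced_iff:
  assumes "Y \<subseteq> {..<n}"
  shows "maximal_independent_set (induced G Y) I \<longleftrightarrow>
    I \<subseteq> Y \<and> (\<forall>v\<in>Y. v \<in> I \<longleftrightarrow> (\<forall>u\<in>I. (v, u) \<notin> parcs G))"
proof -
  have "pair_graph (induced G Y)" using pair_graph_induced[OF graph] assms verts by simp
  then have "sym (parcs (induced G Y))" "irrefl (parcs (induced G Y))"
    by (simp_all add: pair_graph_iff)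
  then show ?thesis
    by (subst maximal_independent_set_iff) (simp_all add: induced_def, blast)
qed

text \<open>Vertices of \<open>X\<close> with a neighbour in \<open>J\<close> are excluded by
  \<open>J\<close>; for the other vertices of \<open>X\<close> only \<open>I \<inter> X\<close>
  decides, so \<open>I \<inter> X\<close> is maximal among them. Conversely
  \<open>J \<union> K\<close> need not be a maximal independent set of \<open>G\<close>:
  \<open>J\<close> may contain an edge, or a vertex outside \<open>X\<close> may be left
  undominated. Hence every candidate is checked.\<close>

lemma MIS_outside_eq:
  assumes X: "X \<subseteq> {..<n}" and J: "J \<inter> X = {}"
  shows "{J \<union> K |K. maximal_independent_set (induced G (free_vertices X J)) K \<and> maximal_independent_set G (J \<union> K)} =
    {I. maximal_independent_set G I \<and> I - X = J}" (is "?L = ?R")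
proof (intro equalityI subsetI)
  fix I assume "I \<in> ?L"
  then obtain K where K: "I = J \<union> K" "maximal_independent_set (induced G (free_vertices X J)) K"
    "maximal_independent_set G I" by blast
  have F: "free_vertices X J \<subseteq> X" by (auto simp: free_vertices_def)
  then have "K \<subseteq> X" using K(2) MIS_induced_iff[of "free_vertices X J"] X by blast
  then show "I \<in> ?R" using K J by auto
next
  fix I assume I: "I \<in> ?R"
  then have M: "I \<subseteq> {..<n}" "\<And>v. v < n \<Longrightarrow> v \<in> I \<longleftrightarrow> (\<forall>u\<in>I. (v, u) \<notin> parcs G)"
    by (auto simp: MIS_iff)
  have IJ: "J \<union> (I \<inter> X) = I" using I by auto
  have F: "free_vertices X J \<subseteq> {..<n}" using X by (auto simp: free_vertices_def)
  have "maximal_independent_set (induced G (free_vertices X J)) (I \<inter> X)"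
    unfolding MIS_induced_iff[OF F]
  proof (intro conjI ballI)
    show "I \<inter> X \<subseteq> free_vertices X J"
    proof
      fix v assume v: "v \<in> I \<inter> X"
      then have "\<forall>u\<in>I. (v, u) \<notin> parcs G" using M X by blast
      moreover have "J \<subseteq> I" using I by auto
      ultimately show "v \<in> free_vertices X J" using v by (auto simp: free_vertices_def)
    qed
    fix v assume v: "v \<in> free_vertices X J"
    then have vn: "v < n" "v \<in> X" "\<forall>u\<in>J. (v, u) \<notin> parcs G" using F by (auto simp: free_vertices_def)
    have "v \<in> I \<longleftrightarrow> (\<forall>u\<in>J \<union> (I \<inter> X). (v, u) \<notin> parcs G)" using M(2)[OF vn(1)] IJ by simp
    also have "\<dots> \<longleftrightarrow> (\<forall>u\<in>I \<inter> X. (v, u) \<notin> parcs G)" using vn(3) by blast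
    finally show "v \<in> I \<inter> X \<longleftrightarrow> (\<forall>u\<in>I \<inter> X. (v, u) \<notin> parcs G)" using vn(2) by blast
  qed
  then show "I \<in> ?L" using I IJ unfolding mem_Collect_eq by (intro exI[of _ "I \<inter> X"]) simp
qed

text \<open>Old sets have their part outside \<open>X\<close> in \<open>E\<close>, new ones have it
  equal to \<open>J\<close>, so no repetition arises between them; among the new ones the part
  inside \<open>X\<close> recovers the decoded set. If \<open>J\<close> meets \<open>X\<close>, no
  set has \<open>J\<close> as its part outside \<open>X\<close>, and nothing is added.\<close>

lemma extend_listing:
  assumes X: "X \<subseteq> {..<n}" and L: "distinct L" "set L = {I. maximal_independent_set G I \<and> I - X \<in> E}"
    and J: "J \<notin> E"
    and Ks: "distinct Ks" "set Ks = {K. maximal_independent_set (compress G (free_vertices X J)) K}"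
  defines "L' \<equiv> L @ filter (\<lambda>I. maximal_independent_set G I \<and> J \<inter> X = {})
      (map (\<lambda>K. J \<union> unrank (free_vertices X J) K) Ks)"
  shows "distinct L' \<and> set L' = {I. maximal_independent_set G I \<and> I - X \<in> insert J E}"
proof (cases "J \<inter> X = {}")
  case True
  let ?Y = "free_vertices X J"
  have Y: "?Y \<subseteq> pverts G" "?Y \<subseteq> X" using X verts by (auto simp: free_vertices_def)
  note bij = unrank_MIS[OF graph Y(1)]
  have img: "unrank ?Y ` set Ks = {I. maximal_independent_set (induced G ?Y) I}"
    using bij Ks(2) by (simp add: bij_betw_def)
  have "inj_on (unrank ?Y) (set Ks)" using bij Ks(2) by (simp add: bij_betw_def)
  then have "inj_on (\<lambda>K. J \<union> unrank ?Y K) (set Ks)"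
  proof (intro inj_onI, goal_cases)
    case (1 K K')
    have "(J \<union> unrank ?Y K) \<inter> X = unrank ?Y K" for K
      using Y(2) True by (auto simp: unrank_def)
    then have "unrank ?Y K = unrank ?Y K'" using 1(4) by metis
    then show ?case using 1 by (auto dest: inj_onD)
  qed
  then have dist: "distinct (map (\<lambda>K. J \<union> unrank ?Y K) Ks)"
    using Ks(1) by (simp add: distinct_map)
  have "set (filter (\<lambda>I. maximal_independent_set G I \<and> J \<inter> X = {})
      (map (\<lambda>K. J \<union> unrank ?Y K) Ks)) =
    {J \<union> K |K. K \<in> unrank ?Y ` set Ks \<and> maximal_independent_set G (J \<union> K)}"
    using True by auto
  also have "\<dots> = {I. maximal_independent_set G I \<and> I - X = J}"
    unfolding img using MIS_outside_eq[OF X True] by simp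
  finally have new: "set (filter (\<lambda>I. maximal_independent_set G I \<and> J \<inter> X = {})
      (map (\<lambda>K. J \<union> unrank ?Y K) Ks)) = {I. maximal_independent_set G I \<and> I - X = J}" .
  have "distinct L'"
    unfolding L'_def distinct_append new using L J dist by auto
  moreover have "set L' = {I. maximal_independent_set G I \<and> I - X \<in> insert J E}"
    unfolding L'_def set_append new using L(2) by auto
  ultimately show ?thesis by simp
next
  case False
  then have "L' = L" by (simp add: L'_def)
  moreover have "I - X \<noteq> J" for I :: "nat set" using False by auto
  ultimately show ?thesis using L by auto
qed

text \<open>Here \<open>ok\<close> stands for sparseness of the induced subgraph and
  \<open>K\<close> for the size of the unknown part \<open>A\<close>; \<open>K\<close> does not
  occur in the program.\<close>

lemma wp_enumerate_MIS:
  fixes ok :: "nat set \<Rightarrow> bool"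
  assumes ok: "ok {}"
      "\<And>X. X \<subseteq> {..<n} \<Longrightarrow> ok X \<Longrightarrow> card X < K \<Longrightarrow>
        \<exists>F\<subseteq>{..<n}. card F \<le> p \<and> ok (sym_diff X F) \<and> card X < card (sym_diff X F)"
      "K \<le> n + 1"
    and outside: "\<And>X I. X \<subseteq> {..<n} \<Longrightarrow> ok X \<Longrightarrow> K \<le> card X \<Longrightarrow> maximal_independent_set G I \<Longrightarrow>
      card (I - X) \<le> q"
    and sub: "\<And>X Y. ok X \<Longrightarrow> Y \<subseteq> X \<Longrightarrow> ok Y"
    and P1: "\<And>Y. Y \<subseteq> {..<n} \<Longrightarrow>
      \<exists>k s'. exec P1 (input_store (compress G Y)) k s' \<and> k \<le> T1 \<and> (reg s' 0 \<noteq> 0 \<longleftrightarrow> ok Y)"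
    and P2: "\<And>Y. Y \<subseteq> {..<n} \<Longrightarrow> ok Y \<Longrightarrow>
      \<exists>k s'. exec P2 (input_store (compress G Y)) k s' \<and> k \<le> T2 \<and>
        distinct (listed_sets (card Y) s') \<and>
        set (listed_sets (card Y) s') = {K. maximal_independent_set (compress G Y) K}"
  shows "\<exists>k s. exec (enumerate_MIS p q P1 P2) (input_store G) k s \<and>
    k \<le> 9 + (n + 1) * (subsets_time n (40 * (n + 1) ^ 2 + 8 * T1) p + 5) +
      subsets_time n (100 * (n + 1) ^ 2 * (T2 + 1)) q \<and>
    distinct (listed_sets n s) \<and> set (listed_sets n s) = {I. maximal_independent_set G I}"
proof -
  let ?B1 = "40 * (n + 1) ^ 2 + 8 * T1" and ?B2 = "100 * (n + 1) ^ 2 * (T2 + 1)"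
  let ?post = "\<lambda>s t. t \<le> 9 + (n + 1) * (subsets_time n ?B1 p + 5) + subsets_time n ?B2 q \<and>
    distinct (listed_sets n s) \<and> set (listed_sets n s) = {I. maximal_independent_set G I}"
  let ?s0 = "(input_store G)\<lparr>reg := (reg (input_store G))(1 := 1)\<rparr>"
  have in0: "reg (input_store G) x = (if x = 0 then n else 0)"
    "arr (input_store G) a i = (if a = 0 \<and> i < n * n \<and> (i div n, i mod n) \<in> parcs G then 1 else 0)"
    for x a i
    by (auto simp: input_store_def Let_def verts)
  have lt: "u * n + v < n * n" if "u < n" "v < n" for u v
  proof -
    have "u * n + v < Suc u * n" using that by simp
    also have "\<dots> \<le> n * n" using that by (intro mult_le_mono1) simp
    finally show ?thesis .
  qed
  have s0: "env ?s0" "holds_set {} ?s0" "arr ?s0 2 = ind {}"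
    using lt by (auto simp: env_def holds_set_def in0 ind_def fun_eq_iff)
  have phase2: "wp (for_subsets q (list_extensions P2)) (\<lambda>s' t'. (\<exists>L. listing s' L \<and> distinct L \<and>
      set L = {I. maximal_independent_set G I}) \<and> t' \<le> t + subsets_time n ?B2 q) s t"
    if s: "env s" "holds_set X s" "arr s 2 = ind {}" "listing s []" "reg s (40 + 2 * q) = n"
      and X: "ok X" "K \<le> card X" for s t X
  proof -
    let ?Inv = "\<lambda>E s. env s \<and> holds_set X s \<and>
      (\<exists>L. listing s L \<and> distinct L \<and> set L = {I. maximal_independent_set G I \<and> I - X \<in> E})"
    have Xn: "X \<subseteq> {..<n}" using s by (simp add: holds_set_def)
    have "wp (for_subsets q (list_extensions P2)) (\<lambda>s' t'. ?Inv ({} \<union> small_subsets n q {}) s' \<and>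
      arr s' 2 = ind {} \<and> t' \<le> t + subsets_time n ?B2 q) s t"
    proof (rule wp_for_subsets[where n = n and Q = q])
      fix E J s t
      assume I: "?Inv E s" and J: "arr s 2 = ind J" "J \<subseteq> {..<n}" "J \<notin> E"
      then obtain L where L: "listing s L" "distinct L"
          "set L = {I. maximal_independent_set G I \<and> I - X \<in> E}" by blast
      \<comment> \<open>The enumeration program is guaranteed to halt on sparse inputs only. The
        free vertices lie in \<open>X\<close>, so heredity applies.\<close>
      have "free_vertices X J \<subseteq> X" by (auto simp: free_vertices_def)
      then obtain k s' where k: "exec P2 (input_store (compress G (free_vertices X J))) k s'" "k \<le> T2"
        "distinct (listed_sets (card (free_vertices X J)) s')"
        "set (listed_sets (card (free_vertices X J)) s') = {K. maximal_independent_set (compress G (free_vertices X J)) K}"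
        using P2[of "free_vertices X J"] sub[OF X(1)] Xn by blast
      have "env s" "holds_set X s" using I by auto
      note ext = wp_list_extensions[OF this J(1) L(1) J(2) k(1-3)]
      show "wp (list_extensions P2) (\<lambda>s' t'. ?Inv (insert J E) s' \<and> t' \<le> t + ?B2) s t"
        by (rule wp_mono[OF ext]) (use extend_listing[OF Xn L(2,3) J(3) k(3,4)] in blast)
    next
      show "1 \<notin> written_regs (list_extensions P2)" "written_regs (list_extensions P2) \<inter> {40..} = {}"
        "2 \<notin> written_arrs (list_extensions P2)" using written_list_extensions[of P2] by fastforce+
    next
      fix E s s'
      assume I: "?Inv E s" and fr: "frame ({4} \<union> {40..}) {2} s s'"
      have "reg s' 0 = reg s 0" "reg s' 1 = reg s 1" "reg s' 3 = reg s 3" "reg s' 17 = reg s 17"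
        "reg s' 15 = reg s 15" "reg s' 16 = reg s 16" "arr s' 1 = arr s 1"
        "arr s' 0 = arr s 0" "arr s' 3 = arr s 3" "\<And>a. 5 \<le> a \<Longrightarrow> arr s' a = arr s a"
        using fr by (auto simp: frame_def)
      then show "?Inv E s'" using I by (auto simp: env_def holds_set_def listing_def)
    next
      show "?Inv {} s" using s by auto
    qed (use s in \<open>auto simp: env_def\<close>)
    then show ?thesis
    proof (rule wp_mono, goal_cases)
      case (1 s' t')
      \<comment> \<open>All possible parts outside \<open>X\<close> are small enough to have been
        visited, so the final invariant covers all maximal independent sets.\<close>
      have "I - X \<in> small_subsets n q {}" if "maximal_independent_set G I" for I
        using outside[OF Xn X that] that by (auto simp: small_subsets_def MIS_iff)
      then show ?case using 1 by auto
    qed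
  qed
  have phase1: "wp (local_search p P1) (\<lambda>s' t'. env s' \<and> arr s' 2 = ind {} \<and>
    (\<exists>X. holds_set X s' \<and> ok X \<and> K \<le> card X) \<and>
    t' \<le> 0 + 1 + 4 + (n + 1) * (subsets_time n ?B1 p + 5)) ?s0 (0 + 1)"
    by (rule wp_local_search[OF s0]) (rule ok P1; assumption)+
  \<comment> \<open>The summand 9 consists of 1 step for the constant register, 4 of the search
    outside its passes, and 2 each before and after the listing phase.\<close>
  have "wp (enumerate_MIS p q P1 P2) ?post (input_store G) 0"
    unfolding enumerate_MIS_def
  proof (rule wp_Seq[THEN iffD2], rule wp_Const[THEN iffD2], rule wp_Seq[THEN iffD2],
      rule wp_conseq[OF phase1], goal_cases)
    case (1 s1 t1)
    then obtain X where X: "holds_set X s1" "ok X" "K \<le> card X" and s1: "env s1" "arr s1 2 = ind {}"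
      by blast
    have "15 \<notin> written_regs (local_search p P1)" "16 \<notin> written_regs (local_search p P1)"
      using written_local_search[of p P1] by auto
    then have r: "reg s1 15 = 0" "reg s1 16 = 0" "reg s1 0 = n"
      using 1(2) s1 by (simp_all add: frame_def in0 env_def)
    let ?s2 = "s1\<lparr>reg := (reg s1)(4 := 0, 40 + 2 * q := n)\<rparr>"
    have phase2': "wp (for_subsets q (list_extensions P2)) (\<lambda>s' t'. (\<exists>L. listing s' L \<and> distinct L \<and>
      set L = {I. maximal_independent_set G I}) \<and> t' \<le> t1 + 1 + 1 + subsets_time n ?B2 q)
      ?s2 (t1 + 1 + 1)"
      by (rule phase2[OF _ _ _ _ _ X(2,3)]) (use X s1 r in \<open>auto simp: env_def holds_set_def listing_def\<close>)
    have step: "wp (Seq (Const 4 0) (Seq (Add (40 + 2 * q) 0 4) (Seq P R))) Q s1 t1"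
      if "wp P (wp R Q) ?s2 (t1 + 1 + 1)" for P R Q
      using that r by simp
    show ?case
    proof (rule step, rule wp_mono[OF phase2'], goal_cases)
      case (1 s3 t3)
      then obtain L where L: "listing s3 L" "distinct L" "set L = {I. maximal_independent_set G I}"
        by blast
      have "listed_sets n (s3\<lparr>reg := (reg s3)(4 := 0, 0 := reg s3 16)\<rparr>) = L"
        using listed_sets_listing[of "s3\<lparr>reg := (reg s3)(4 := 0)\<rparr>" L] L(1)
        by (simp add: listing_def)
      then show ?case using L 1 \<open>_ \<and> _ \<and> _ \<and> t1 \<le> _\<close> by simp
    qed
  qed
  then show ?thesis by (simp add: wp_def)
qed

end

text \<open>The simulated runs take place on graphs with at most \<open>n\<close> vertices;
  monotonicity of the time bounds is what makes their values at \<open>n\<close> valid for all of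
  them.\<close>

lemma sparse_dense_enumerate:
  assumes cls: "sparse_dense_classes c \<S> \<D>" and cf: "\<D> \<subseteq> co_clique_free_graphs t"
    and mono: "mono T1" "mono T2"
    and P1: "\<And>n G. pair_graph G \<Longrightarrow> pverts G = {..<n} \<Longrightarrow>
      \<exists>k s. exec P1 (input_store G) k s \<and> k \<le> T1 n \<and> (reg s 0 \<noteq> 0 \<longleftrightarrow> G \<in> \<S>)"
    and P2: "\<And>n G. G \<in> \<S> \<Longrightarrow> pverts G = {..<n} \<Longrightarrow>
      \<exists>k s. exec P2 (input_store G) k s \<and> k \<le> T2 n \<and> distinct (listed_sets n s) \<and>
        set (listed_sets n s) = {I. maximal_independent_set G I}"
    and G: "G \<in> sparse_dense_graphs \<S> \<D>" "pverts G = {..<n}"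
  shows "\<exists>k s. exec (enumerate_MIS (2 * c + 1) (t + c) P1 P2) (input_store G) k s \<and>
    k \<le> total_time c t n (T1 n) (T2 n) \<and> distinct (listed_sets n s) \<and>
    set (listed_sets n s) = {I. maximal_independent_set G I}"
proof -
  from G obtain A B where pg: "pair_graph G" and part: "sparse_dense_partition \<S> \<D> G A B"
    by (auto simp: sparse_dense_graphs_def)
  interpret labelled_graph n G using pg G(2) by (rule labelled_graph.intro)
  have AB: "A \<union> B = pverts G" "induced G A \<in> \<S>"
    using part by (auto simp: sparse_dense_partition_def)
  have gc: "graph_class \<S>" and her: "hereditary \<S>"
    using cls by (auto simp: sparse_dense_classes_def)
  have sub: "induced G Y \<in> \<S>" if "induced G X \<in> \<S>" "Y \<subseteq> X" for X Y
    using hereditary_induced[OF her that] .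
  have size: "card Y \<le> n" if "Y \<subseteq> {..<n}" for Y
    using card_mono[OF _ that] by simp
  have comp: "pair_graph (compress G Y)" "pverts (compress G Y) = {..<card Y}"
    "compress G Y \<in> \<S> \<longleftrightarrow> induced G Y \<in> \<S>" if Y: "Y \<subseteq> {..<n}" for Y
  proof -
    have "finite Y" using Y finite_subset by blast
    then show "pair_graph (compress G Y)" by (rule pair_graph_compress[OF pg])
    show "pverts (compress G Y) = {..<card Y}" by (simp add: compress_def)
    show "compress G Y \<in> \<S> \<longleftrightarrow> induced G Y \<in> \<S>"
      by (rule compress_in_class_iff[OF gc pg]) (simp add: verts Y)
  qed
  show ?thesis unfolding total_time_def
  proof (rule wp_enumerate_MIS[where ok = "\<lambda>X. induced G X \<in> \<S>" and K = "card A"])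
    show "induced G {} \<in> \<S>" using sub[OF AB(2)] by simp
    have "A \<subseteq> {..<n}" using AB(1) G(2) by blast
    then show "card A \<le> n + 1" using size[of A] by linarith
  next
    fix X assume "X \<subseteq> {..<n}" "induced G X \<in> \<S>" "card X < card A"
    then show "\<exists>F\<subseteq>{..<n}. card F \<le> 2 * c + 1 \<and> induced G (sym_diff X F) \<in> \<S> \<and>
        card X < card (sym_diff X F)"
      using sparse_dense_exchange[OF cls part pg, of X] verts by simp
  next
    fix X I assume "X \<subseteq> {..<n}" "induced G X \<in> \<S>" "card A \<le> card X" "maximal_independent_set G I"
    then show "card (I - X) \<le> t + c"
      using sparse_dense_outside[OF cls part cf pg, of X I] verts by simp
  next
    fix Y assume Y: "Y \<subseteq> {..<n}"
    from P1[OF comp(1,2)[OF Y]] obtain k s' where k: "exec P1 (input_store (compress G Y)) k s'"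
      "k \<le> T1 (card Y)" "reg s' 0 \<noteq> 0 \<longleftrightarrow> compress G Y \<in> \<S>" by blast
    show "\<exists>k s'. exec P1 (input_store (compress G Y)) k s' \<and> k \<le> T1 n \<and>
        (reg s' 0 \<noteq> 0 \<longleftrightarrow> induced G Y \<in> \<S>)"
      using k(1) order.trans[OF k(2) monoD[OF mono(1) size[OF Y]]] k(3)[unfolded comp(3)[OF Y]]
      by blast
  next
    fix Y assume Y: "Y \<subseteq> {..<n}" "induced G Y \<in> \<S>"
    then have "compress G Y \<in> \<S>" using comp(3)[OF Y(1)] by simp
    from P2[OF this comp(2)[OF Y(1)]] obtain k s' where k: "exec P2 (input_store (compress G Y)) k s'"
      "k \<le> T2 (card Y)" and listed: "distinct (listed_sets (card Y) s')"
      "set (listed_sets (card Y) s') = {K. maximal_independent_set (compress G Y) K}" by blast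
    show "\<exists>k s'. exec P2 (input_store (compress G Y)) k s' \<and> k \<le> T2 n \<and>
        distinct (listed_sets (card Y) s') \<and>
        set (listed_sets (card Y) s') = {K. maximal_independent_set (compress G Y) K}"
      using k(1) order.trans[OF k(2) monoD[OF mono(2) size[OF Y(1)]]] listed by blast
  qed (use sub in blast)
qed

text \<open>\<open>C\<close> is chosen before the classes, \<open>t\<close> and the time bounds, so
  it depends on \<open>c\<close> alone. For \<open>n\<close> below 2 the power of \<open>n\<close>
  is at most 1 and could not absorb any overhead, hence the restriction on \<open>n\<close>.\<close>

theorem theorem2:
  fixes c :: nat
  shows "\<exists>C::nat. \<forall>(\<S>::ngraph set) (\<D>::ngraph set) (t::nat) (T1::nat \<Rightarrow> nat) (T2::nat \<Rightarrow> nat).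
    sparse_dense_classes c \<S> \<D> \<and>
    \<D> \<subseteq> co_clique_free_graphs t \<and>
    mono T1 \<and> mono T2 \<and>
    recognizable_in_time \<S> T1 \<and>
    MIS_enumerable_in_time \<S> T2 \<longrightarrow>
    (\<exists>T. MIS_enumerable_in_time (sparse_dense_graphs \<S> \<D>) T \<and>
         (\<forall>n\<ge>2. T n \<le> (T1 n + T2 n) * n ^ (C * t)))"
proof (intro exI[of _ "6 * c + 18"] allI impI, elim conjE)
  fix \<S> \<D> :: "ngraph set" and t :: nat and T1 T2 :: "nat \<Rightarrow> nat"
  assume cls: "sparse_dense_classes c \<S> \<D>" and cf: "\<D> \<subseteq> co_clique_free_graphs t"
    and mono: "mono T1" "mono T2"
    and rec: "recognizable_in_time \<S> T1" and enum: "MIS_enumerable_in_time \<S> T2"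
  show "\<exists>T. MIS_enumerable_in_time (sparse_dense_graphs \<S> \<D>) T \<and>
         (\<forall>n\<ge>2. T n \<le> (T1 n + T2 n) * n ^ ((6 * c + 18) * t))"
  proof (cases "t = 0")
    \<comment> \<open>The exponent vanishes, so no polynomial overhead is available. But the empty
      set is an independent set of size 0 in every graph, so the dense class is empty and there is
      no sparse-dense graph at all.\<close>
    case True
    have "independent_set G {}" for G :: ngraph by (simp add: independent_set_def)
    then have "\<D> = {}" using cf True by (force simp: co_clique_free_graphs_def)
    then have "sparse_dense_graphs \<S> \<D> = {}"
      by (simp add: sparse_dense_graphs_def sparse_dense_partition_def)
    then have "MIS_enumerable_in_time (sparse_dense_graphs \<S> \<D>) (\<lambda>_. 0)"
      by (simp add: MIS_enumerable_in_time_def)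
    then show ?thesis by (intro exI[of _ "\<lambda>_. 0"]) simp
  next
    case False
    from rec obtain P1 where P1: "\<And>n G. pair_graph G \<Longrightarrow> pverts G = {..<n} \<Longrightarrow>
      \<exists>k s. exec P1 (input_store G) k s \<and> k \<le> T1 n \<and> (reg s 0 \<noteq> 0 \<longleftrightarrow> G \<in> \<S>)"
      unfolding recognizable_in_time_def by blast
    from enum obtain P2 where P2: "\<And>n G. G \<in> \<S> \<Longrightarrow> pverts G = {..<n} \<Longrightarrow>
      \<exists>k s. exec P2 (input_store G) k s \<and> k \<le> T2 n \<and> distinct (listed_sets n s) \<and>
        set (listed_sets n s) = {I. maximal_independent_set G I}"
      unfolding MIS_enumerable_in_time_def by blast
    let ?T = "\<lambda>n. total_time c t n (T1 n) (T2 n)"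
    \<comment> \<open>The claimed bound is a pure product, so its first factor must be positive.
      This holds because the recognition program halts on the edgeless graph with \<open>n\<close>
      vertices and every run takes at least one step.\<close>
    have T1: "1 \<le> T1 n" for n
    proof -
      let ?G = "\<lparr>pverts = {..<n}, parcs = {}\<rparr> :: ngraph"
      have "pair_graph ?G" by (simp add: pair_graph_iff sym_def irrefl_def)
      from P1[OF this, of n] obtain k s where "exec P1 (input_store ?G) k s" "k \<le> T1 n" by auto
      then show ?thesis using exec_pos by fastforce
    qed
    have "MIS_enumerable_in_time (sparse_dense_graphs \<S> \<D>) ?T"
      unfolding MIS_enumerable_in_time_def
      using sparse_dense_enumerate[OF cls cf mono P1 P2] by blast
    moreover have "\<forall>n\<ge>2. ?T n \<le> (T1 n + T2 n) * n ^ ((6 * c + 18) * t)"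
      using total_time_bound[OF _ _ T1] False by simp
    ultimately show ?thesis by blast
  qed
qed

end
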